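(* Fix an integer $\ell \ge 1$, and for each $n \ge \ell$ let $G_{\mathrm{DPLR}}$ and $G_{\mathrm{Diag}}$ be the transfer functions of the size-$n$ systems $\Sigma_{\mathrm{DPLR}}$ and $\Sigma_{\mathrm{Diag}}$ (defined in the context). Then the function $G_{\mathrm{DPLR}}(s) - G_{\mathrm{Diag}}(s)$ does not converge to zero uniformly on the imaginary axis $\{s \in \mathbb{C} : \mathrm{Re}(s)=0\}$ as $n \to \infty$. In particular, for every $n \ge \ell$ there exists an input signal $\mathbf{u}_n \in L^1(\mathbb{R}) \cap L^2(\mathbb{R})$ such that, if $\mathbf{y}_{n,\mathrm{DPLR}}$ and $\mathbf{y}_{n,\mathrm{Diag}}$ denote the outputs of the size-$n$ systems $\Sigma_{\mathrm{DPLR}}$ and $\Sigma_{\mathrm{Diag}}$ with input $\mathbf{u}_n$, then $\|\mathbf{y}_{n,\mathrm{DPLR}} - \mathbf{y}_{n,\mathrm{Diag}}\|_{L^2}$ does not converge to $0$ as $n \to \infty$.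
   Context: For each $n\ge 1$ define the real $n \times n$ matrix $\mathbf{A}_H$ and the column vector $\mathbf{B}_H \in \mathbb{R}^n$ (HiPPO-LegS) by $(A_H)_{jk} = -\sqrt{2j-1}\sqrt{2k-1}$ if $j>k$, $(A_H)_{jj} = -j$, $(A_H)_{jk}=0$ if $j<k$; and $(B_H)_j = \sqrt{(2j-1)/2}$. Define $\mathbf{A}_H^\perp = \mathbf{A}_H + \mathbf{B}_H\mathbf{B}_H^\top$; explicitly, $(A_H^\perp)_{jk} = -\tfrac12\sqrt{2j-1}\sqrt{2k-1}$ if $j>k$, $(A_H^\perp)_{jj} = -\tfrac12$, $(A_H^\perp)_{jk} = \tfrac12\sqrt{2j-1}\sqrt{2k-1}$ if $j<k$. This matrix is normal; write $\mathbf{A}_H^\perp = \mathbf{V}_H \boldsymbol{\Lambda}_H \mathbf{V}_H^{-1}$ with $\mathbf{V}_H$ unitary and $\boldsymbol{\Lambda}_H$ diagonal. The DPLR system $\Sigma_{\mathrm{DPLR}}$ has $\mathbf{A}_{\mathrm{DPLR}} = \boldsymbol{\Lambda}_H - \mathbf{V}_H^{-1}\mathbf{B}_H\mathbf{B}_H^\top\mathbf{V}_H$ $(= \mathbf{V}_H^{-1}\mathbf{A}_H\mathbf{V}_H)$, $\mathbf{B}_{\mathrm{DPLR}} = \mathbf{V}_H^{-1}\mathbf{B}_H$. The diagonal system $\Sigma_{\mathrm{Diag}}$ has $\mathbf{A}_{\mathrm{Diag}} = \boldsymbol{\Lambda}_H$, $\mathbf{B}_{\mathrm{Diag}} = \tfrac12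 \mathbf{V}_H^{-1}\mathbf{B}_H$. For $n \ge \ell$ both have output matrix $\mathbf{C}_{\mathrm{DPLR}} = \mathbf{C}_{\mathrm{Diag}} = \mathbf{e}_\ell^\top \mathbf{V}_H$, where $\mathbf{e}_\ell$ is the $\ell$th standard basis vector, and a common scalar $\mathbf{D}_{\mathrm{DPLR}} = \mathbf{D}_{\mathrm{Diag}} \in \mathbb{C}$. A system $(\mathbf{A},\mathbf{B},\mathbf{C},\mathbf{D})$ is the linear time-invariant system $\mathbf{x}'(t) = \mathbf{A}\mathbf{x}(t)+\mathbf{B}\mathbf{u}(t)$, $\mathbf{y}(t) = \mathbf{C}\mathbf{x}(t)+\mathbf{D}\mathbf{u}(t)$. Its transfer function is $G(s) = \mathbf{C}(s\mathbf{I}-\mathbf{A})^{-1}\mathbf{B}+\mathbf{D}$. All systems here are asymptotically stable (eigenvalues of $\mathbf{A}$ in the open left half-plane), and the map from input $\mathbf{u}$ to output $\mathbf{y}$ (with zero initial state) is understood as $\hat{\mathbf{y}}(s) = G(is)\hat{\mathbf{u}}(s)$, $s\in\mathbb{R}$, where $\hat{\ }$ is the Fourier transform $\hat f(s) = \int_{\mathbb{R}} f(t)e^{-ist}\,dt$ extended to $L^2(\mathbb{R})$. Signals are complex-valued functions on $\mathbb{R}$. *)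

theory Defs
  imports "HOL-Analysis.Analysis" "Jordan_Normal_Form.Schur_Decomposition"
begin

section \<open>The HiPPO-LegS matrices\<close>

text \<open>Matrix entries are indexed from 0 in the library, so the entry in row \<open>i\<close> and column \<open>k\<close>
  below is the one with row index \<open>i + 1\<close> and column index \<open>k + 1\<close> in the usual 1-based
  formulas; thus \<open>2 * i + 1\<close> is the usual \<open>2 j - 1\<close>. Column vectors are \<open>n \<times> 1\<close> matrices and
  row vectors are \<open>1 \<times> n\<close> matrices.\<close>

definition legs_A :: "nat \<Rightarrow> real mat" where
  "legs_A n = mat n n (\<lambda>(i, k).
     if k < i then - sqrt (2 * real i + 1) * sqrt (2 * real k + 1)
     else if i = k then - (real i + 1)
     else 0)"

definition legs_B :: "nat \<Rightarrow> real mat" where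
  "legs_B n = mat n 1 (\<lambda>(i, _). sqrt ((2 * real i + 1) / 2))"

definition legs_A_perp :: "nat \<Rightarrow> real mat" where
  "legs_A_perp n = legs_A n + legs_B n * transpose_mat (legs_B n)"

lemma legs_A_perp_explicit:
  "legs_A_perp n = mat n n (\<lambda>(i, k).
     if k < i then - (1 / 2) * sqrt (2 * real i + 1) * sqrt (2 * real k + 1)
     else if i = k then - (1 / 2)
     else (1 / 2) * sqrt (2 * real i + 1) * sqrt (2 * real k + 1))"
  (is "_ = ?R")
proof (rule eq_matI)
  fix i k assume "i < dim_row ?R" "k < dim_col ?R"
  then have i: "i < n" and k: "k < n" by auto
  have "(legs_B n * transpose_mat (legs_B n)) $$ (i, k) =
      sqrt ((2 * real i + 1) / 2) * sqrt ((2 * real k + 1) / 2)"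
    using i k by (simp add: legs_B_def scalar_prod_def)
  also have "\<dots> = sqrt (2 * real i + 1) * sqrt (2 * real k + 1) / 2"
    by (simp add: real_sqrt_divide)
  finally show "legs_A_perp n $$ (i, k) = ?R $$ (i, k)"
    using i k by (auto simp: legs_A_perp_def legs_A_def legs_B_def)
qed (auto simp: legs_A_perp_def legs_A_def legs_B_def)

abbreviation cmat :: "real mat \<Rightarrow> complex mat" where
  "cmat \<equiv> map_mat complex_of_real"

section \<open>Unitary diagonalization\<close>

text \<open>The inverse of an invertible square matrix; unspecified for all other matrices.\<close>

definition mat_inv :: "complex mat \<Rightarrow> complex mat" where
  "mat_inv M = the (mat_inverse M)"

definition unitary_mat :: "nat \<Rightarrow> complex mat \<Rightarrow> bool" where
  "unitary_mat n U \<longleftrightarrow> U \<in> carrier_mat n n \<and>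
     mat_adjoint U * U = 1\<^sub>m n \<and> U * mat_adjoint U = 1\<^sub>m n"

definition unitary_diagonalization ::
    "nat \<Rightarrow> complex mat \<Rightarrow> complex mat \<Rightarrow> complex mat \<Rightarrow> bool" where
  "unitary_diagonalization n M V \<Lambda> \<longleftrightarrow>
     unitary_mat n V \<and> \<Lambda> \<in> carrier_mat n n \<and> diagonal_mat \<Lambda> \<and> M = V * \<Lambda> * mat_inv V"

section \<open>Linear time-invariant systems\<close>

text \<open>Single-input single-output systems
  \<open>x'(t) = A x(t) + B u(t)\<close>, \<open>y(t) = C x(t) + D u(t)\<close>,
  with \<open>A\<close>, \<open>B\<close>, \<open>C\<close> of sizes \<open>n \<times> n\<close>, \<open>n \<times> 1\<close>, \<open>1 \<times> n\<close>.\<close>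

record lti_system =
  sys_A :: "complex mat"
  sys_B :: "complex mat"
  sys_C :: "complex mat"
  sys_D :: complex

definition transfer_function :: "lti_system \<Rightarrow> complex \<Rightarrow> complex" where
  "transfer_function \<Sigma> s =
     (sys_C \<Sigma> * mat_inv (s \<cdot>\<^sub>m 1\<^sub>m (dim_row (sys_A \<Sigma>)) - sys_A \<Sigma>) * sys_B \<Sigma>) $$ (0, 0) + sys_D \<Sigma>"

text \<open>\<open>l\<close> is counted from 1, hence the shift in \<open>unit_vec\<close>.\<close>

definition unit_row :: "nat \<Rightarrow> nat \<Rightarrow> complex mat" where
  "unit_row n l = mat_of_rows n [unit_vec n (l - 1)]"

definition DPLR_system ::
    "nat \<Rightarrow> nat \<Rightarrow> complex mat \<Rightarrow> complex mat \<Rightarrow> complex \<Rightarrow> lti_system" where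
  "DPLR_system l n V \<Lambda> d =
     \<lparr> sys_A = \<Lambda> - mat_inv V * cmat (legs_B n) * transpose_mat (cmat (legs_B n)) * V,
       sys_B = mat_inv V * cmat (legs_B n),
       sys_C = unit_row n l * V,
       sys_D = d \<rparr>"

definition Diag_system ::
    "nat \<Rightarrow> nat \<Rightarrow> complex mat \<Rightarrow> complex mat \<Rightarrow> complex \<Rightarrow> lti_system" where
  "Diag_system l n V \<Lambda> d =
     \<lparr> sys_A = \<Lambda>,
       sys_B = (1 / 2) \<cdot>\<^sub>m (mat_inv V * cmat (legs_B n)),
       sys_C = unit_row n l * V,
       sys_D = d \<rparr>"

section \<open>Signals and the Fourier transform\<close>

definition in_L1 :: "(real \<Rightarrow> complex) \<Rightarrow> bool" where
  "in_L1 f \<longleftrightarrow> integrable lborel f"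

definition in_L2 :: "(real \<Rightarrow> complex) \<Rightarrow> bool" where
  "in_L2 f \<longleftrightarrow> f \<in> borel_measurable lborel \<and> integrable lborel (\<lambda>t. (cmod (f t))\<^sup>2)"

definition L2_norm :: "(real \<Rightarrow> complex) \<Rightarrow> real" where
  "L2_norm f = sqrt (\<integral>t. (cmod (f t))\<^sup>2 \<partial>lborel)"

definition L2_tendsto :: "(nat \<Rightarrow> real \<Rightarrow> complex) \<Rightarrow> (real \<Rightarrow> complex) \<Rightarrow> bool" where
  "L2_tendsto F f \<longleftrightarrow>
     (\<forall>k. in_L2 (F k)) \<and> in_L2 f \<and> (\<lambda>k. L2_norm (\<lambda>t. F k t - f t)) \<longlonglongrightarrow> 0"

definition fourier :: "(real \<Rightarrow> complex) \<Rightarrow> real \<Rightarrow> complex" where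
  "fourier f s = (\<integral>t. f t * exp (- \<i> * complex_of_real s * complex_of_real t) \<partial>lborel)"

text \<open>The extension of \<open>fourier\<close> from \<open>L\<^sup>1 \<inter> L\<^sup>2\<close> to \<open>L\<^sup>2\<close> by continuity. Since elements of
  \<open>L\<^sup>2\<close> are represented by functions, a transform is determined only almost everywhere, and the
  extension is a relation: \<open>g\<close> is a representative of the transform of \<open>f\<close>.\<close>

definition is_fourier_L2 :: "(real \<Rightarrow> complex) \<Rightarrow> (real \<Rightarrow> complex) \<Rightarrow> bool" where
  "is_fourier_L2 f g \<longleftrightarrow>
     (\<exists>\<phi>. (\<forall>k. in_L1 (\<phi> k)) \<and> L2_tendsto \<phi> f \<and> L2_tendsto (\<lambda>k. fourier (\<phi> k)) g)"

text \<open>\<open>y\<close> is (a representative of) the output for the input \<open>u\<close> and zero initial state.\<close>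

definition is_output :: "lti_system \<Rightarrow> (real \<Rightarrow> complex) \<Rightarrow> (real \<Rightarrow> complex) \<Rightarrow> bool" where
  "is_output \<Sigma> u y \<longleftrightarrow>
     (\<exists>u_hat. is_fourier_L2 u u_hat \<and>
        is_fourier_L2 y (\<lambda>s. transfer_function \<Sigma> (\<i> * complex_of_real s) * u_hat s))"

end

theory Submission
  imports Defs "HOL-Probability.Probability"
begin

text \<open>Put \<open>q n s = (\<Prod>k<n. (s - k) / (s + k + 1))\<close>. Forward substitution solves
  \<open>(s I - A_H) x = B_H\<close> explicitly and gives \<open>B_H\<^sup>T x = (1 - q n s) / 2\<close>; since
  \<open>A_H\<^sup>\<bottom> = A_H + B_H B_H\<^sup>T\<close> is a rank-one perturbation, the two transfer functions are
  \<open>x l + d\<close> and \<open>x l / (1 + q n s) + d\<close>. On the imaginary axis \<open>\<bar>q n (\<i> w)\<bar> = w / sqrt (w\<^sup>2 + n\<^sup>2)\<close>, and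
  its phase crosses \<open>\<pi>\<close> at some \<open>w\<close> of order \<open>n\<^sup>2\<close>, where \<open>1 + q n\<close> is of order
  \<open>n\<^sup>2 / w\<^sup>2\<close>; there the difference \<open>x l q n / (1 + q n)\<close> stays bounded away from 0.

  For the signals, write both transfer functions over a common denominator \<open>D\<close> and take the input
  with Fourier transform \<open>\<alpha> D (\<i> w) / (1 + \<i> w) ^ m\<close>: then the input and both outputs are
  combinations of \<open>t ^ k * exp (- t)\<close> on the half line. Pairing an arbitrary pair of outputs with
  the Fourier transform of \<open>D\<close> truncated to a suitable interval bounds the norm of their
  difference from below by a positive number independent of the representatives, and \<open>\<alpha>\<close> is
  chosen to make this bound 1. Only the multiplication formula is used, not Plancherel's theorem.\<close>

section \<open>Square-integrable functions and the Fourier transform\<close>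

lemma in_L2_cmult:
  assumes "in_L2 f"
  shows "in_L2 (\<lambda>t. c * f t)"
  using assms by (auto simp: in_L2_def norm_mult power_mult_distrib)

lemma in_L2_add:
  assumes "in_L2 f" "in_L2 g"
  shows "in_L2 (\<lambda>t. f t + g t)"
  unfolding in_L2_def
proof
  show "(\<lambda>t. f t + g t) \<in> borel_measurable lborel"
    using assms by (auto simp: in_L2_def)
  have int: "integrable lborel (\<lambda>t. 2 * (cmod (f t))\<^sup>2 + 2 * (cmod (g t))\<^sup>2)"
    using assms by (auto simp: in_L2_def)
  have bound: "(cmod (f t + g t))\<^sup>2 \<le> 2 * (cmod (f t))\<^sup>2 + 2 * (cmod (g t))\<^sup>2" for t
  proof -
    have "(cmod (f t + g t))\<^sup>2 \<le> (cmod (f t) + cmod (g t))\<^sup>2"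
      by (intro power_mono norm_triangle_ineq) auto
    also have "\<dots> \<le> 2 * (cmod (f t))\<^sup>2 + 2 * (cmod (g t))\<^sup>2"
      using sum_squares_bound[of "cmod (f t)" "cmod (g t)"] by (simp add: power2_sum)
    finally show ?thesis .
  qed
  show "integrable lborel (\<lambda>t. (cmod (f t + g t))\<^sup>2)"
    by (rule Bochner_Integration.integrable_bound[OF int])
      (use assms bound in \<open>auto simp: in_L2_def\<close>)
qed

lemma in_L2_diff:
  assumes "in_L2 f" "in_L2 g"
  shows "in_L2 (\<lambda>t. f t - g t)"
  using in_L2_add[OF assms(1) in_L2_cmult[OF assms(2), of "-1"]] by simp

lemma integrable_mult_L2:
  assumes "in_L2 f" "in_L2 g"
  shows "integrable lborel (\<lambda>t. f t * g t)"
proof -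
  have int: "integrable lborel (\<lambda>t. (cmod (f t))\<^sup>2 + (cmod (g t))\<^sup>2)"
    using assms by (auto simp: in_L2_def)
  have "cmod (f t * g t) \<le> (cmod (f t))\<^sup>2 + (cmod (g t))\<^sup>2" for t
  proof -
    have "0 \<le> cmod (f t) * cmod (g t)" by simp
    then show ?thesis
      using sum_squares_bound[of "cmod (f t)" "cmod (g t)"] unfolding norm_mult by linarith
  qed
  then show ?thesis
    by (intro Bochner_Integration.integrable_bound[OF int])
      (use assms in \<open>auto simp: in_L2_def\<close>)
qed

lemma L2_norm_nonneg: "0 \<le> L2_norm f"
  by (simp add: L2_norm_def)

text \<open>The pairing is bilinear, without complex conjugation, because that is the form in which
  the multiplication formula produces it. The inequality itself is that for nonnegative integrals of
  the moduli, which are finite here.\<close>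

lemma L2_Cauchy_Schwarz:
  assumes "in_L2 f" "in_L2 g"
  shows "cmod (\<integral>t. f t * g t \<partial>lborel) \<le> L2_norm f * L2_norm g"
proof -
  let ?F = "\<lambda>t. cmod (f t)" and ?G = "\<lambda>t. cmod (g t)"
  have [measurable]: "f \<in> borel_measurable lborel" "g \<in> borel_measurable lborel"
    using assms by (auto simp: in_L2_def)
  have intF: "integrable lborel (\<lambda>t. (?F t)\<^sup>2)" and intG: "integrable lborel (\<lambda>t. (?G t)\<^sup>2)"
    using assms by (auto simp: in_L2_def)
  have int: "integrable lborel (\<lambda>t. ?F t * ?G t)"
    using integrable_norm[OF integrable_mult_L2[OF assms]] by (simp add: norm_mult)
  have "(\<integral>\<^sup>+t. ennreal (?F t) * ennreal (?G t) \<partial>lborel)\<^sup>2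
      \<le> (\<integral>\<^sup>+t. (ennreal (?F t))\<^sup>2 \<partial>lborel) * (\<integral>\<^sup>+t. (ennreal (?G t))\<^sup>2 \<partial>lborel)"
    by (rule Cauchy_Schwarz_nn_integral) auto
  then have "(\<integral>\<^sup>+t. ennreal (?F t * ?G t) \<partial>lborel)\<^sup>2
      \<le> (\<integral>\<^sup>+t. ennreal ((?F t)\<^sup>2) \<partial>lborel) * (\<integral>\<^sup>+t. ennreal ((?G t)\<^sup>2) \<partial>lborel)"
    by (simp add: ennreal_mult' ennreal_power)
  then have "(\<integral>t. ?F t * ?G t \<partial>lborel)\<^sup>2 \<le> (\<integral>t. (?F t)\<^sup>2 \<partial>lborel) * (\<integral>t. (?G t)\<^sup>2 \<partial>lborel)"
    by (simp add: nn_integral_eq_integral int intF intG ennreal_power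
        flip: ennreal_mult)
  then have "(\<integral>t. ?F t * ?G t \<partial>lborel) \<le> L2_norm f * L2_norm g"
    unfolding L2_norm_def by (metis real_le_rsqrt real_sqrt_mult)
  moreover have "cmod (\<integral>t. f t * g t \<partial>lborel) \<le> (\<integral>t. ?F t * ?G t \<partial>lborel)"
    using integral_norm_bound[of lborel "\<lambda>t. f t * g t"] by (simp add: norm_mult)
  ultimately show ?thesis by linarith
qed

text \<open>By Cauchy-Schwarz, pairing with a fixed square-integrable function is continuous along
  L2 convergence. This carries the multiplication formula from the integrable approximations to
  their L2 limits.\<close>

lemma L2_tendsto_integral_mult:
  assumes "L2_tendsto F f" "in_L2 g"
  shows "(\<lambda>k. \<integral>t. F k t * g t \<partial>lborel) \<longlonglongrightarrow> (\<integral>t. f t * g t \<partial>lborel)"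
proof (rule LIM_zero_cancel, rule Lim_null_comparison)
  have F: "in_L2 (F k)" and f: "in_L2 f" for k
    using assms by (auto simp: L2_tendsto_def)
  have "(\<integral>t. F k t * g t \<partial>lborel) - (\<integral>t. f t * g t \<partial>lborel) = (\<integral>t. (F k t - f t) * g t \<partial>lborel)" for k
    using integrable_mult_L2[OF F assms(2)] integrable_mult_L2[OF f assms(2)]
    by (simp add: left_diff_distrib)
  then show "\<forall>\<^sub>F k in sequentially. cmod ((\<integral>t. F k t * g t \<partial>lborel) - (\<integral>t. f t * g t \<partial>lborel))
      \<le> L2_norm (\<lambda>t. F k t - f t) * L2_norm g"
    using L2_Cauchy_Schwarz[OF in_L2_diff[OF F f] assms(2)] by simp
  show "(\<lambda>k. L2_norm (\<lambda>t. F k t - f t) * L2_norm g) \<longlonglongrightarrow> 0"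
    using assms by (intro tendsto_mult_left_zero) (auto simp: L2_tendsto_def)
qed

section \<open>The Fourier transform of integrable functions and the multiplication formula\<close>

lemma integrable_mult_character:
  assumes "integrable lborel f"
  shows "integrable lborel (\<lambda>t. f t * exp (- \<i> * complex_of_real s * complex_of_real t))"
  by (rule Bochner_Integration.integrable_bound[OF assms])
    (use borel_measurable_integrable[OF assms] in \<open>auto simp: norm_mult\<close>)

lemma fourier_measurable:
  assumes "integrable lborel f"
  shows "fourier f \<in> borel_measurable lborel"
  using borel_measurable_integrable[OF assms] unfolding fourier_def[abs_def] by measurable

lemma norm_fourier_le: "cmod (fourier f s) \<le> (\<integral>t. cmod (f t) \<partial>lborel)"
proof -
  have "cmod (fourier f s) \<le> (\<integral>t. cmod (f t * exp (- \<i> * complex_of_real s * complex_of_real t)) \<partial>lborel)"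
    unfolding fourier_def by (rule integral_norm_bound)
  then show ?thesis by (simp add: norm_mult)
qed

text \<open>Fubini for \<open>f x * g y * exp (- \<i> * y * x)\<close>: its modulus is the product
  of the moduli of \<open>f\<close> and \<open>g\<close>, hence integrable on the plane, and the
  kernel is symmetric in the two variables.\<close>

lemma fourier_multiplication:
  assumes f: "integrable lborel f" and g: "integrable lborel g"
  shows "(\<integral>s. fourier f s * g s \<partial>lborel) = (\<integral>t. f t * fourier g t \<partial>lborel)"
proof -
  define h where "h x y = f x * g y * exp (- \<i> * complex_of_real y * complex_of_real x)" for x y
  have [measurable]: "f \<in> borel_measurable borel" "g \<in> borel_measurable borel"
    using f g by (auto dest: borel_measurable_integrable)
  have "integrable (lborel \<Otimes>\<^sub>M lborel) (\<lambda>(x, y). h x y)"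
  proof (rule lborel_pair.Fubini_integrable)
    show "(\<lambda>(x, y). h x y) \<in> borel_measurable (lborel \<Otimes>\<^sub>M lborel)"
      unfolding h_def by measurable
    show "integrable lborel (\<lambda>x. \<integral>y. norm (case (x, y) of (x, y) \<Rightarrow> h x y) \<partial>lborel)"
      using f by (simp add: h_def norm_mult)
    show "AE x in lborel. integrable lborel (\<lambda>y. case (x, y) of (x, y) \<Rightarrow> h x y)"
    proof (rule AE_I2)
      fix x
      have "integrable lborel (\<lambda>y. f x * (g y * exp (- \<i> * complex_of_real x * complex_of_real y)))"
        by (intro integrable_mult_right integrable_mult_character g)
      then show "integrable lborel (\<lambda>y. case (x, y) of (x, y) \<Rightarrow> h x y)"
        by (simp add: h_def mult_ac)
    qed
  qed
  then have "(\<integral>y. \<integral>x. h x y \<partial>lborel \<partial>lborel) = (\<integral>x. \<integral>y. h x y \<partial>lborel \<partial>lborel)"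
    by (rule lborel_pair.Fubini_integral)
  moreover have "(\<integral>x. h x y \<partial>lborel) = fourier f y * g y" for y
  proof -
    have "(\<integral>x. h x y \<partial>lborel) = (\<integral>x. f x * exp (- \<i> * complex_of_real y * complex_of_real x) * g y \<partial>lborel)"
      by (simp add: h_def mult_ac)
    then show ?thesis by (simp add: fourier_def)
  qed
  moreover have "(\<integral>y. h x y \<partial>lborel) = f x * fourier g x" for x
  proof -
    have "(\<integral>y. h x y \<partial>lborel) = (\<integral>y. f x * (g y * exp (- \<i> * complex_of_real x * complex_of_real y)) \<partial>lborel)"
      by (simp add: h_def mult_ac)
    then show ?thesis by (simp add: fourier_def)
  qed
  ultimately show ?thesis by simp
qed

text \<open>Both sides are limits of the classical formula along the approximating sequence. Square
  integrability of \<open>g\<close> gives convergence on the transform side, that of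
  \<open>fourier g\<close> on the signal side. The right-hand side does not involve the
  representative \<open>h\<close>, which is what makes later bounds independent of it.\<close>

lemma is_fourier_L2_multiplication:
  assumes "is_fourier_L2 f h" "in_L1 g" "in_L2 g" "in_L2 (fourier g)"
  shows "(\<integral>s. h s * g s \<partial>lborel) = (\<integral>t. f t * fourier g t \<partial>lborel)"
proof -
  obtain \<phi> where \<phi>: "\<And>k. in_L1 (\<phi> k)" "L2_tendsto \<phi> f" "L2_tendsto (\<lambda>k. fourier (\<phi> k)) h"
    using assms(1) by (auto simp: is_fourier_L2_def)
  have "(\<integral>s. fourier (\<phi> k) s * g s \<partial>lborel) = (\<integral>t. \<phi> k t * fourier g t \<partial>lborel)" for k
    using \<phi>(1) assms(2) by (intro fourier_multiplication) (auto simp: in_L1_def)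
  then show ?thesis
    using L2_tendsto_integral_mult[OF \<phi>(3) assms(3)] L2_tendsto_integral_mult[OF \<phi>(2) assms(4)]
    by (auto intro: LIMSEQ_unique)
qed

text \<open>The constant sequence approximates. Membership of \<open>fourier f\<close> in L2 is
  assumed rather than derived; it is checked by explicit decay wherever this is applied.\<close>

lemma is_fourier_L2_fourier:
  assumes "in_L1 f" "in_L2 f" "in_L2 (fourier f)"
  shows "is_fourier_L2 f (fourier f)"
  unfolding is_fourier_L2_def
  by (rule exI[of _ "\<lambda>_. f"]) (use assms in \<open>auto simp: L2_tendsto_def L2_norm_def\<close>)

lemma is_fourier_L2_in_L2: "is_fourier_L2 f h \<Longrightarrow> in_L2 f"
  by (auto simp: is_fourier_L2_def L2_tendsto_def)

section \<open>Square integrability of Fourier transforms from first-order decay\<close>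

lemma in_L2_if_decay:
  assumes "f \<in> borel_measurable lborel" "\<And>s. cmod (f s) \<le> A" "\<And>s. \<bar>s\<bar> * cmod (f s) \<le> B"
  shows "in_L2 f"
  unfolding in_L2_def
proof
  have int: "integrable lborel (\<lambda>s::real. (A\<^sup>2 + B\<^sup>2) * inverse (1 + s\<^sup>2))"
    using integrable_inverse_1_plus_square
    by (intro integrable_mult_right) (simp add: set_integrable_def einterval_def)
  have "(cmod (f s))\<^sup>2 \<le> (A\<^sup>2 + B\<^sup>2) * inverse (1 + s\<^sup>2)" for s
  proof -
    have "(cmod (f s))\<^sup>2 \<le> A\<^sup>2" "(\<bar>s\<bar> * cmod (f s))\<^sup>2 \<le> B\<^sup>2"
      by (intro power_mono assms; simp)+
    then have "(cmod (f s))\<^sup>2 * (1 + s\<^sup>2) \<le> A\<^sup>2 + B\<^sup>2"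
      by (simp add: power_mult_distrib algebra_simps)
    moreover have "0 < 1 + s\<^sup>2" by (simp add: add_pos_nonneg)
    ultimately show ?thesis by (simp add: field_simps)
  qed
  then show "integrable lborel (\<lambda>t. (cmod (f t))\<^sup>2)"
    using assms(1) by (intro Bochner_Integration.integrable_bound[OF int]) (auto simp: abs_le_iff intro: order_trans)
qed (use assms in auto)

lemma in_L1_L2_window:
  assumes "continuous_on {a..b} f"
  shows "in_L1 (\<lambda>t. indicator {a..b} t *\<^sub>R f t)" "in_L2 (\<lambda>t. indicator {a..b} t *\<^sub>R f t)"
proof -
  show L1: "in_L1 (\<lambda>t. indicator {a..b} t *\<^sub>R f t)"
    using borel_integrable_atLeastAtMost'[OF assms] by (simp add: in_L1_def set_integrable_def)
  have "integrable lborel (\<lambda>t. indicator {a..b} t *\<^sub>R (cmod (f t))\<^sup>2)"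
    using borel_integrable_atLeastAtMost'[of a b "\<lambda>t. (cmod (f t))\<^sup>2"] assms
    by (simp add: set_integrable_def continuous_intros)
  moreover have "indicator {a..b} t *\<^sub>R (cmod (f t))\<^sup>2 = (cmod (indicator {a..b} t *\<^sub>R f t))\<^sup>2" for t
    by (simp add: indicator_def)
  ultimately show "in_L2 (\<lambda>t. indicator {a..b} t *\<^sub>R f t)"
    using L1 by (simp add: in_L2_def in_L1_def borel_measurable_integrable)
qed

text \<open>Integration by parts on the interval expresses \<open>\<i> * s * fourier g s\<close>
  through the transform of the truncated derivative and two boundary terms, all bounded in
  \<open>s\<close>. The jumps of the truncation at the endpoints thus still leave decay of order 1 /
  |s|, enough for square integrability.\<close>

lemma in_L2_fourier_window:
  assumes ab: "a \<le> b"
    and deriv: "\<And>t. t \<in> {a..b} \<Longrightarrow> (f has_vector_derivative f' t) (at t within {a..b})"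
    and cont': "continuous_on {a..b} f'"
  shows "in_L2 (fourier (\<lambda>t. indicator {a..b} t *\<^sub>R f t))"
proof (rule in_L2_if_decay)
  define g where "g = (\<lambda>t. indicator {a..b} t *\<^sub>R f t)"
  define g' where "g' = (\<lambda>t. indicator {a..b} t *\<^sub>R f' t)"
  have cont: "continuous_on {a..b} f"
    using deriv by (meson continuous_on_vector_derivative)
  have g: "integrable lborel g" and g': "integrable lborel g'"
    using in_L1_L2_window(1)[OF cont] in_L1_L2_window(1)[OF cont']
    by (auto simp: in_L1_def g_def g'_def)
  show "fourier (\<lambda>t. indicator {a..b} t *\<^sub>R f t) \<in> borel_measurable lborel"
    using fourier_measurable[OF g] by (simp add: g_def)
  show "cmod (fourier (\<lambda>t. indicator {a..b} t *\<^sub>R f t) s) \<le> (\<integral>t. cmod (g t) \<partial>lborel)" for s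
    using norm_fourier_le[of g] unfolding g_def .
  fix s :: real
  let ?e = "\<lambda>t::real. exp (- \<i> * complex_of_real s * complex_of_real t)"
  have "(\<integral>t. indicator {a..b} t *\<^sub>R (f' t * ?e t + f t * (- \<i> * s * ?e t)) \<partial>lborel)
      = f b * ?e b - f a * ?e a"
  proof (rule integral_FTC_Icc[OF ab])
    fix t assume "a \<le> t" "t \<le> b"
    then have "(f has_vector_derivative f' t) (at t within {a..b})" using deriv by auto
    moreover have "(?e has_vector_derivative (- \<i> * s * ?e t)) (at t within {a..b})"
      by (rule has_vector_derivative_real_field) (auto intro!: derivative_eq_intros)
    ultimately show "((\<lambda>t. f t * ?e t) has_vector_derivative f' t * ?e t + f t * (- \<i> * s * ?e t))
        (at t within {a..b})"
      by (auto intro!: derivative_eq_intros)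
  qed (intro continuous_intros cont cont')
  moreover have "(\<lambda>t. indicator {a..b} t *\<^sub>R (f' t * ?e t + f t * (- \<i> * s * ?e t)))
      = (\<lambda>t. g' t * ?e t + (- \<i> * s) * (g t * ?e t))"
    by (auto simp: g_def g'_def indicator_def)
  ultimately have "fourier g' s + (- \<i> * s) * fourier g s = f b * ?e b - f a * ?e a"
    using integrable_mult_character[OF g, of s] integrable_mult_character[OF g', of s]
    by (simp add: fourier_def)
  then have "\<i> * s * fourier g s = fourier g' s - (f b * ?e b - f a * ?e a)"
    by (simp add: algebra_simps)
  then have "cmod (\<i> * s * fourier g s) = cmod (fourier g' s - (f b * ?e b - f a * ?e a))"
    by simp
  also have "\<dots> \<le> cmod (fourier g' s) + (cmod (f b * ?e b) + cmod (f a * ?e a))"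
    by (meson norm_triangle_ineq4 add_left_mono order_trans)
  also have "\<dots> \<le> (\<integral>t. cmod (g' t) \<partial>lborel) + (cmod (f b) + cmod (f a))"
    using norm_fourier_le[of g' s] by (simp add: norm_mult)
  finally show "\<bar>s\<bar> * cmod (fourier (\<lambda>t. indicator {a..b} t *\<^sub>R f t) s)
      \<le> (\<integral>t. cmod (g' t) \<partial>lborel) + (cmod (f b) + cmod (f a))"
    by (simp add: norm_mult g_def)
qed

section \<open>Rational Fourier transforms\<close>

text \<open>The function \<open>t ^ k * exp (- t) / fact k\<close> for \<open>t \<ge> 0\<close>,
  extended by zero to negative \<open>t\<close>. These functions generate all signals constructed
  below.\<close>

definition erl :: "nat \<Rightarrow> real \<Rightarrow> complex" where
  "erl k = (\<lambda>t. complex_of_real (erlang_density k 1 t))"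

lemma integrable_erlang_density:
  assumes "0 < l"
  shows "integrable lborel (erlang_density k l)"
proof (rule integrableI_nn_integral_finite)
  show "(\<integral>\<^sup>+ x. ennreal (erlang_density k l x) \<partial>lborel) = ennreal (fact k / fact k)"
    using nn_integral_erlang_ith_moment[OF assms, of k 0] by simp
qed (use assms in auto)

lemma in_L1_erl: "in_L1 (erl k)"
  using integrable_erlang_density[of 1 k] by (simp add: in_L1_def erl_def)

text \<open>The square of an Erlang density of shape \<open>k\<close> and rate 1 is a constant
  multiple of the one with index \<open>2 * k\<close> and rate 2.\<close>

lemma in_L2_erl: "in_L2 (erl k)"
  unfolding in_L2_def
proof
  show "erl k \<in> borel_measurable lborel"
    using in_L1_erl by (simp add: in_L1_def borel_measurable_integrable)
  have "(\<lambda>t. (cmod (erl k t))\<^sup>2)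
      = (\<lambda>t. fact (2 * k) / ((fact k)\<^sup>2 * 2 ^ Suc (2 * k)) * erlang_density (2 * k) 2 t)"
  proof
    fix t :: real
    have e: "(exp (- t))\<^sup>2 = exp (- (2 * t))" by (simp flip: exp_of_nat_mult)
    have p: "(t ^ k)\<^sup>2 = t ^ (2 * k)" by (simp flip: power_mult add: mult.commute)
    show "(cmod (erl k t))\<^sup>2
        = fact (2 * k) / ((fact k)\<^sup>2 * 2 ^ Suc (2 * k)) * erlang_density (2 * k) 2 t"
      by (simp add: erl_def erlang_density_def power_mult_distrib power_divide e p del: power_Suc)
  qed
  then show "integrable lborel (\<lambda>t. (cmod (erl k t))\<^sup>2)"
    by (simp add: integrable_erlang_density)
qed

lemma erl_at_top: "(erl k \<longlongrightarrow> 0) at_top"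
proof -
  have "((\<lambda>t::real. inverse (fact k) * (t ^ k / exp t)) \<longlongrightarrow> 0) at_top"
    by (intro tendsto_mult_right_zero tendsto_power_div_exp_0)
  moreover have "\<forall>\<^sub>F t::real in at_top. inverse (fact k) * (t ^ k / exp t) = erlang_density k 1 t"
    using eventually_ge_at_top[of 0]
    by eventually_elim (simp add: erlang_density_def exp_minus field_simps)
  ultimately have "(erlang_density k 1 \<longlongrightarrow> 0) at_top"
    by (rule Lim_transform_eventually)
  from tendsto_of_real[OF this] show ?thesis by (simp add: erl_def)
qed

text \<open>Only the one-sided limit of the antiderivative at 0 enters, so \<open>f\<close> may jump
  there, as \<open>erl 0\<close> does; the point 0 itself is a null set.\<close>

lemma integral_half_line_FTC:
  fixes f F :: "real \<Rightarrow> complex"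
  assumes "integrable lborel f" "\<And>t. t < 0 \<Longrightarrow> f t = 0"
    and "\<And>t. 0 < t \<Longrightarrow> (F has_vector_derivative f t) (at t)"
    and "\<And>t. 0 < t \<Longrightarrow> isCont f t"
    and "(F \<longlongrightarrow> A) (at_right 0)" "(F \<longlongrightarrow> B) at_top"
  shows "(\<integral>t. f t \<partial>lborel) = B - A"
proof -
  have "interval_lebesgue_integral lborel 0 \<infinity> f = B - A"
  proof (rule interval_integral_FTC_integrable)
    show "set_integrable lborel (einterval 0 \<infinity>) f"
      using assms(1) unfolding set_integrable_def by (rule integrable_mult_indicator[rotated]) auto
    show "((F \<circ> real_of_ereal) \<longlongrightarrow> A) (at_right 0)"
      using assms(5) by (simp add: zero_ereal_def ereal_tendsto_simps1)
    show "((F \<circ> real_of_ereal) \<longlongrightarrow> B) (at_left \<infinity>)"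
      using assms(6) by (simp add: ereal_tendsto_simps1)
  qed (use assms in \<open>auto simp: zero_ereal_def\<close>)
  moreover have "(\<integral>t. f t \<partial>lborel) = (\<integral>t. indicator {0<..} t *\<^sub>R f t \<partial>lborel)"
  proof (rule integral_cong_AE)
    have "f t = indicator {0<..} t *\<^sub>R f t" if "t \<noteq> 0" for t
      using that assms(2)[of t] by (auto simp: indicator_def)
    then show "AE t in lborel. f t = indicator {0<..} t *\<^sub>R f t"
      using AE_lborel_singleton[of "0::real"] by auto
  qed (use assms(1) in \<open>auto dest: borel_measurable_integrable\<close>)
  ultimately show ?thesis
    by (simp add: interval_lebesgue_integral_def set_lebesgue_integral_def einterval_def zero_ereal_def greaterThan_def)
qed

lemma one_plus_imaginary_nonzero: "1 + \<i> * complex_of_real s \<noteq> 0"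
  by (simp add: complex_eq_iff)

lemma erlang_density_deriv:
  assumes "0 < t"
  shows "(erlang_density (Suc k) 1 has_real_derivative erlang_density k 1 t - erlang_density (Suc k) 1 t) (at t)"
proof -
  have "((\<lambda>t. t ^ Suc k * exp (- t) / fact (Suc k)) has_real_derivative
      (real (Suc k) * t ^ k * exp (- t) - t ^ Suc k * exp (- t)) / fact (Suc k)) (at t)"
    by (rule derivative_eq_intros refl | simp)+
  moreover have "(real (Suc k) * t ^ k * exp (- t) - t ^ Suc k * exp (- t)) / fact (Suc k)
      = erlang_density k 1 t - erlang_density (Suc k) 1 t"
    using assms by (simp add: erlang_density_def diff_divide_distrib del: of_nat_Suc power_Suc)
  ultimately have "((\<lambda>t. t ^ Suc k * exp (- t) / fact (Suc k)) has_real_derivative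
      erlang_density k 1 t - erlang_density (Suc k) 1 t) (at t)" by simp
  then show ?thesis
    by (rule has_field_derivative_transform_within_open[of _ _ _ "{0<..}"])
      (use assms in \<open>auto simp: erlang_density_def\<close>)
qed

lemma isCont_erl:
  assumes "0 < t"
  shows "isCont (erl k) t"
proof -
  have "continuous_on {0<..} (\<lambda>t. complex_of_real (t ^ k * exp (- t) / fact k))"
    by (intro continuous_intros) auto
  then have "continuous_on {0<..} (erl k)"
    by (rule continuous_on_cong[THEN iffD1, OF refl, rotated]) (simp add: erl_def erlang_density_def)
  then show ?thesis
    using assms by (simp add: continuous_on_eq_continuous_at)
qed

text \<open>The successor index matters: \<open>erl 0\<close> tends to 1 at the origin from the
  right. This is why the base case of the transform computation uses a different
  antiderivative.\<close>

lemma erl_at_right_0: "(erl (Suc k) \<longlongrightarrow> 0) (at_right 0)"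
proof (rule Lim_transform_eventually)
  have "isCont (\<lambda>t. complex_of_real (t ^ Suc k * exp (- t) / fact (Suc k))) 0"
    by (intro continuous_intros) simp
  then show "((\<lambda>t. complex_of_real (t ^ Suc k * exp (- t) / fact (Suc k))) \<longlongrightarrow> 0) (at_right 0)"
    by (auto simp: isCont_def intro: filterlim_mono[OF _ _ at_le])
  show "\<forall>\<^sub>F t in at_right 0. complex_of_real (t ^ Suc k * exp (- t) / fact (Suc k)) = erl (Suc k) t"
    using eventually_at_right_less[of 0]
    by eventually_elim (simp add: erl_def erlang_density_def)
qed

text \<open>Induction on \<open>k\<close>. The base case integrates an exponential. In the step,
  with z = 1 + i s, the derivative of \<open>erl (Suc k)\<close> times the character is
  (\<open>erl k\<close> - z \<open>erl (Suc k)\<close>) times the character; the boundary terms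
  vanish, so each index contributes one more factor 1 / z.\<close>

lemma fourier_erl: "fourier (erl k) s = 1 / (1 + \<i> * complex_of_real s) ^ Suc k"
proof (induction k)
  case 0
  define z where "z = 1 + \<i> * complex_of_real s"
  have z: "z \<noteq> 0" "Re z = 1"
    using one_plus_imaginary_nonzero by (auto simp: z_def)
  let ?F = "\<lambda>t::real. - exp (- z * complex_of_real t) / z"
  have "(\<integral>t. erl 0 t * exp (- \<i> * complex_of_real s * complex_of_real t) \<partial>lborel) = 0 - (- 1 / z)"
  proof (rule integral_half_line_FTC[where F = ?F])
    show "integrable lborel (\<lambda>t. erl 0 t * exp (- \<i> * complex_of_real s * complex_of_real t))"
      using in_L1_erl by (intro integrable_mult_character) (simp add: in_L1_def)
    fix t :: real assume t: "0 < t"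
    have "(?F has_vector_derivative exp (- z * complex_of_real t)) (at t)"
      using z by (intro has_vector_derivative_real_field) (auto intro!: derivative_eq_intros)
    moreover have "erl 0 t * exp (- \<i> * complex_of_real s * complex_of_real t) = exp (- z * complex_of_real t)"
      using t by (simp add: erl_def erlang_density_def z_def algebra_simps flip: exp_add exp_of_real)
    ultimately show "(?F has_vector_derivative erl 0 t * exp (- \<i> * complex_of_real s * complex_of_real t)) (at t)"
      by simp
    show "isCont (\<lambda>t. erl 0 t * exp (- \<i> * complex_of_real s * complex_of_real t)) t"
      using isCont_erl[OF t] by (intro continuous_intros)
  next
    have "isCont ?F 0" by (intro continuous_intros z)
    then show "(?F \<longlongrightarrow> - 1 / z) (at_right 0)"
      by (auto simp: isCont_def intro: filterlim_mono[OF _ _ at_le])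
    have "((\<lambda>t. exp (- t)) \<longlongrightarrow> (0::real)) at_top"
      by (rule filterlim_compose[OF exp_at_bot]) (simp add: filterlim_uminus_at_bot_at_top)
    then have "((\<lambda>t. exp (- t) / cmod z) \<longlongrightarrow> 0) at_top"
      by (rule tendsto_divide_zero)
    then show "(?F \<longlongrightarrow> 0) at_top"
      by (intro tendsto_norm_zero_cancel[of ?F]) (simp add: norm_divide z)
  qed (simp add: erl_def erlang_density_def)
  then show ?case by (simp add: fourier_def z_def)
next
  case (Suc k)
  let ?z = "1 + \<i> * complex_of_real s"
  let ?e = "\<lambda>t::real. exp (- \<i> * complex_of_real s * complex_of_real t)"
  have int: "integrable lborel (\<lambda>t. erl k t * ?e t)" for k
    using in_L1_erl by (intro integrable_mult_character) (simp add: in_L1_def)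
  have "(\<integral>t. erl k t * ?e t - ?z * (erl (Suc k) t * ?e t) \<partial>lborel) = 0 - 0"
  proof (rule integral_half_line_FTC[where F = "\<lambda>t. erl (Suc k) t * ?e t"])
    show "integrable lborel (\<lambda>t. erl k t * ?e t - ?z * (erl (Suc k) t * ?e t))"
      by (intro Bochner_Integration.integrable_diff integrable_mult_right int)
    fix t :: real assume t: "0 < t"
    have "(erl (Suc k) has_vector_derivative erl k t - erl (Suc k) t) (at t)"
      using has_vector_derivative_of_real[OF erlang_density_deriv[OF t, of k]]
      by (simp add: erl_def)
    moreover have "(?e has_vector_derivative (- \<i> * s * ?e t)) (at t)"
      by (rule has_vector_derivative_real_field) (auto intro!: derivative_eq_intros)
    ultimately show "((\<lambda>t. erl (Suc k) t * ?e t) has_vector_derivative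
        erl k t * ?e t - ?z * (erl (Suc k) t * ?e t)) (at t)"
      by (auto intro!: derivative_eq_intros simp: algebra_simps)
    show "isCont (\<lambda>t. erl k t * ?e t - ?z * (erl (Suc k) t * ?e t)) t"
      using isCont_erl[OF t] by (intro continuous_intros)
  next
    show "((\<lambda>t. erl (Suc k) t * ?e t) \<longlongrightarrow> 0) (at_right 0)"
      using tendsto_norm_zero[OF erl_at_right_0[of k]]
      by (intro tendsto_norm_zero_cancel[of "\<lambda>t. erl (Suc k) t * ?e t"]) (simp add: norm_mult)
    show "((\<lambda>t. erl (Suc k) t * ?e t) \<longlongrightarrow> 0) at_top"
      using tendsto_norm_zero[OF erl_at_top[of "Suc k"]]
      by (intro tendsto_norm_zero_cancel[of "\<lambda>t. erl (Suc k) t * ?e t"]) (simp add: norm_mult)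
  qed (simp add: erl_def erlang_density_def)
  then have "fourier (erl k) s = ?z * fourier (erl (Suc k)) s"
    using int[of k] int[of "Suc k"] by (simp add: fourier_def)
  then have "?z * fourier (erl (Suc k)) s = 1 / ?z ^ Suc k"
    using Suc.IH by simp
  then show ?case
    using nonzero_mult_div_cancel_left[OF one_plus_imaginary_nonzero[of s], of "fourier (erl (Suc k)) s"]
    by (simp add: mult.commute)
qed

lemma in_L2_fourier_erl: "in_L2 (fourier (erl k))"
proof (rule in_L2_if_decay)
  show "fourier (erl k) \<in> borel_measurable lborel"
    using in_L1_erl by (intro fourier_measurable) (simp add: in_L1_def)
  fix s :: real
  let ?z = "1 + \<i> * complex_of_real s"
  have z: "1 \<le> cmod ?z" "\<bar>s\<bar> \<le> cmod ?z"
    using abs_Re_le_cmod[of ?z] abs_Im_le_cmod[of ?z] by auto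
  have "cmod ?z * 1 \<le> cmod ?z * cmod ?z ^ k"
    using z one_le_power[OF z(1)] by (intro mult_left_mono) auto
  then have zk: "cmod ?z \<le> cmod ?z ^ Suc k" by simp
  have eq: "cmod (fourier (erl k) s) = 1 / cmod ?z ^ Suc k"
    unfolding fourier_erl norm_divide norm_power by simp
  show "cmod (fourier (erl k) s) \<le> 1"
    unfolding eq using one_le_power[OF z(1), of "Suc k"] by (simp add: divide_le_eq)
  show "\<bar>s\<bar> * cmod (fourier (erl k) s) \<le> 1"
    unfolding eq using z zk by (simp add: divide_le_eq)
qed

section \<open>Proper rational functions with a single pole as Fourier transforms\<close>

lemma fourier_add_cmult:
  assumes "in_L1 f" "in_L1 g"
  shows "fourier (\<lambda>t. f t + c * g t) s = fourier f s + c * fourier g s"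
proof -
  have "fourier (\<lambda>t. f t + c * g t) s
      = (\<integral>t. f t * exp (- \<i> * complex_of_real s * complex_of_real t)
         + c * (g t * exp (- \<i> * complex_of_real s * complex_of_real t)) \<partial>lborel)"
    unfolding fourier_def by (simp add: algebra_simps)
  then show ?thesis
    using integrable_mult_character[of f s] integrable_mult_character[of g s] assms
    by (simp add: in_L1_def fourier_def)
qed

text \<open>Partial fractions at the only pole -1: splitting p(z) as (1 + z) q(z) + p(-1) leaves a
  fraction with one power less and a multiple of the transform of \<open>erl m\<close>.\<close>

lemma rational_function_is_fourier:
  assumes "degree p < m"
  shows "\<exists>f. in_L1 f \<and> in_L2 f \<and> in_L2 (fourier f) \<and>
    (\<forall>s. fourier f s = poly p (\<i> * complex_of_real s) / (1 + \<i> * complex_of_real s) ^ m)"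
  using assms
proof (induction m arbitrary: p)
  case (Suc m)
  define q where "q = synthetic_div p (-1)"
  define c where "c = poly p (-1)"
  have p: "poly p z = (1 + z) * poly q z + c" for z
    using arg_cong[OF synthetic_div_correct'[of "-1" p], of "\<lambda>p. poly p z"]
    by (simp add: q_def c_def algebra_simps)
  have "\<exists>f. in_L1 f \<and> in_L2 f \<and> in_L2 (fourier f) \<and>
    (\<forall>s. fourier f s = poly q (\<i> * complex_of_real s) / (1 + \<i> * complex_of_real s) ^ m)"
  proof (cases "degree p = 0")
    \<comment> \<open>The constant case cannot go through the induction hypothesis: then
      \<open>q\<close> is zero, but \<open>degree q < m\<close> fails when
      \<open>m = 0\<close>.\<close>
    case True
    then have "q = 0" by (simp add: q_def synthetic_div_eq_0_iff)
    moreover have "fourier (\<lambda>_. 0) = (\<lambda>_. 0)" by (simp add: fourier_def fun_eq_iff)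
    ultimately show ?thesis
      by (intro exI[of _ "\<lambda>_. 0"]) (simp add: in_L1_def in_L2_def)
  next
    case False
    then have "degree q < m" using Suc.prems by (simp add: q_def degree_synthetic_div)
    then show ?thesis by (rule Suc.IH)
  qed
  then obtain f where f: "in_L1 f" "in_L2 f" "in_L2 (fourier f)"
      "\<And>s. fourier f s = poly q (\<i> * complex_of_real s) / (1 + \<i> * complex_of_real s) ^ m"
    by blast
  have eq: "fourier (\<lambda>t. f t + c * erl m t) = (\<lambda>s. fourier f s + c * fourier (erl m) s)"
    by (simp add: fun_eq_iff fourier_add_cmult f in_L1_erl)
  show ?case
  proof (intro exI[of _ "\<lambda>t. f t + c * erl m t"] conjI allI)
    show "in_L1 (\<lambda>t. f t + c * erl m t)"
      using f in_L1_erl by (simp add: in_L1_def)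
    show "in_L2 (\<lambda>t. f t + c * erl m t)"
      by (intro in_L2_add in_L2_cmult f in_L2_erl)
    show "in_L2 (fourier (\<lambda>t. f t + c * erl m t))"
      unfolding eq by (intro in_L2_add in_L2_cmult f in_L2_fourier_erl)
    show "fourier (\<lambda>t. f t + c * erl m t) s
        = poly p (\<i> * complex_of_real s) / (1 + \<i> * complex_of_real s) ^ Suc m" for s
    proof -
      have "x / z ^ m + c / z ^ Suc m = (z * x + c) / z ^ Suc m" if "z \<noteq> 0" for x z :: complex
        using that by (simp add: divide_simps)
      from this[OF one_plus_imaginary_nonzero[of s]] show ?thesis
        by (simp add: eq f(4) fourier_erl p del: power_Suc)
    qed
  qed
qed simp

section \<open>Separating the outputs of two rational systems\<close>

text \<open>If every interval integral vanished, the indefinite integral starting at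
  \<open>x0\<close> would be constant, whereas its right derivative at \<open>x0\<close> is
  \<open>F x0\<close>.\<close>

lemma integral_nonzero_interval:
  fixes F :: "real \<Rightarrow> complex"
  assumes cont: "continuous_on UNIV F" and "F x0 \<noteq> 0"
  shows "\<exists>a b. a \<le> b \<and> (\<integral>s. indicator {a..b} s *\<^sub>R F s \<partial>lborel) \<noteq> 0"
proof (rule ccontr)
  assume "\<not> ?thesis"
  then have zero: "(\<integral>s. indicator {a..b} s *\<^sub>R F s \<partial>lborel) = 0" if "a \<le> b" for a b
    using that by blast
  have "integral {x0..x} F = 0" if "x \<in> {x0..x0 + 1}" for x
  proof -
    have "set_integrable lborel {x0..x} F"
      by (intro borel_integrable_atLeastAtMost' continuous_on_subset[OF cont]) auto
    from set_borel_integral_eq_integral(2)[OF this] show ?thesis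
      using zero[of x0 x] that by (simp add: set_lebesgue_integral_def)
  qed
  moreover have "((\<lambda>u. integral {x0..u} F) has_vector_derivative F x0) (at x0 within {x0..x0 + 1})"
    by (rule integral_has_vector_derivative) (auto intro: continuous_on_subset[OF cont])
  ultimately have "((\<lambda>u. 0) has_vector_derivative F x0) (at x0 within {x0..x0 + 1})"
    by (intro has_vector_derivative_transform[of x0 "{x0..x0 + 1}" "\<lambda>u. 0" "\<lambda>u. integral {x0..u} F"])
      simp_all
  moreover have "((\<lambda>u. 0) has_vector_derivative 0) (at x0 within {x0..x0 + 1})"
    by simp
  ultimately have "F x0 = 0"
    by (rule vector_derivative_unique_within[rotated 1]) (simp add: trivial_limit_within islimpt_Icc)
  with assms(2) show False by simp
qed

lemma poly_imaginary_axis_has_vector_derivative: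
  "((\<lambda>t::real. poly p (\<i> * complex_of_real t)) has_vector_derivative
     \<i> * poly (pderiv p) (\<i> * complex_of_real t)) (at t within S)"
proof -
  have "((\<lambda>z. poly p (\<i> * z)) has_field_derivative \<i> * poly (pderiv p) (\<i> * complex_of_real t))
      (at (complex_of_real t))"
    by (auto intro!: derivative_eq_intros)
  then show ?thesis by (rule has_vector_derivative_real_field)
qed

lemma poly_imaginary_axis_nonzero:
  assumes "p \<noteq> 0"
  shows "\<exists>s. poly p (\<i> * complex_of_real s) \<noteq> 0"
proof (rule ccontr)
  assume "\<not> ?thesis"
  then have "range (\<lambda>s. \<i> * complex_of_real s) \<subseteq> {z. poly p z = 0}" by auto
  then have "finite (range (\<lambda>s. \<i> * complex_of_real s))"
    using poly_roots_finite[OF assms] finite_subset by blast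
  moreover have "inj (\<lambda>s. \<i> * complex_of_real s)" by (auto intro: injI)
  ultimately have "finite (UNIV :: real set)" by (rule finite_imageD)
  then show False using infinite_UNIV_char_0 by blast
qed

lemma poly_window:
  fixes p :: "complex poly"
  assumes "a \<le> b"
  defines "g \<equiv> \<lambda>t::real. indicator {a..b} t *\<^sub>R poly p (\<i> * complex_of_real t)"
  shows "in_L1 g" "in_L2 g" "in_L2 (fourier g)"
  unfolding g_def
  by (intro in_L1_L2_window continuous_intros
      in_L2_fourier_window[OF assms(1) poly_imaginary_axis_has_vector_derivative])+

text \<open>Multiplying the window by the common denominator \<open>D\<close> keeps the test function in the class of
  truncated polynomials even after multiplication by the transfer function, so that the
  multiplication formula can be applied twice.\<close>

lemma integral_output_fourier_window:
  assumes G: "\<And>s. transfer_function \<Sigma> (\<i> * complex_of_real s)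
      = poly N (\<i> * complex_of_real s) / poly D (\<i> * complex_of_real s)"
    and D: "\<And>s. poly D (\<i> * complex_of_real s) \<noteq> 0"
    and ab: "a \<le> b" and u: "in_L1 u" and y: "is_output \<Sigma> u y"
  shows "(\<integral>t. y t * fourier (\<lambda>t. indicator {a..b} t *\<^sub>R poly D (\<i> * complex_of_real t)) t \<partial>lborel)
    = (\<integral>s. indicator {a..b} s *\<^sub>R (fourier u s * poly N (\<i> * complex_of_real s)) \<partial>lborel)"
proof -
  let ?win = "\<lambda>p t. indicator {a..b} t *\<^sub>R poly p (\<i> * complex_of_real t)"
  obtain u_hat where u_hat: "is_fourier_L2 u u_hat"
    and y_hat: "is_fourier_L2 y (\<lambda>s. transfer_function \<Sigma> (\<i> * complex_of_real s) * u_hat s)"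
    using y by (auto simp: is_output_def)
  have "(\<integral>t. y t * fourier (?win D) t \<partial>lborel)
      = (\<integral>s. transfer_function \<Sigma> (\<i> * complex_of_real s) * u_hat s * ?win D s \<partial>lborel)"
    using is_fourier_L2_multiplication[OF y_hat poly_window[OF ab]] by simp
  also have "\<dots> = (\<integral>s. u_hat s * ?win N s \<partial>lborel)"
    by (intro Bochner_Integration.integral_cong) (auto simp: G D indicator_def)
  \<comment> \<open>Passing to the signal side and back replaces the unknown representative
    \<open>u_hat\<close> by the concrete function \<open>fourier u\<close>, without an appeal to
    uniqueness of the L2 transform.\<close>
  also have "\<dots> = (\<integral>s. u s * fourier (?win N) s \<partial>lborel)"
    by (rule is_fourier_L2_multiplication[OF u_hat poly_window[OF ab]])
  also have "\<dots> = (\<integral>s. fourier u s * ?win N s \<partial>lborel)"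
    using fourier_multiplication[of u "?win N"] u poly_window(1)[OF ab] by (simp add: in_L1_def)
  finally show ?thesis by simp
qed

text \<open>One fixed test function \<open>w\<close> detects the difference of the outputs: its
  pairing with any two outputs is a number computed from the numerators alone. Cauchy-Schwarz then
  turns the value of the pairing into a lower bound on the norm, uniformly in the
  representatives.\<close>

lemma input_separating_outputs:
  assumes G1: "\<And>s. transfer_function \<Sigma>1 (\<i> * complex_of_real s)
      = poly N1 (\<i> * complex_of_real s) / poly D (\<i> * complex_of_real s)"
    and G2: "\<And>s. transfer_function \<Sigma>2 (\<i> * complex_of_real s)
      = poly N2 (\<i> * complex_of_real s) / poly D (\<i> * complex_of_real s)"
    and D: "\<And>s. poly D (\<i> * complex_of_real s) \<noteq> 0"
    and neq: "N1 \<noteq> N2"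
  shows "\<exists>u. in_L1 u \<and> in_L2 u \<and> (\<exists>y. is_output \<Sigma>1 u y) \<and> (\<exists>y. is_output \<Sigma>2 u y) \<and>
    (\<forall>y1 y2. is_output \<Sigma>1 u y1 \<longrightarrow> is_output \<Sigma>2 u y2 \<longrightarrow> 1 \<le> L2_norm (\<lambda>t. y1 t - y2 t))"
proof -
  \<comment> \<open>With \<open>m\<close> above all three degrees, the input and both outputs have
    proper rational transforms.\<close>
  define m where "m = Suc (max (degree D) (max (degree N1) (degree N2)))"
  have deg: "degree D < m" "degree N1 < m" "degree N2 < m" by (auto simp: m_def)
  \<comment> \<open>Up to the factor \<open>\<alpha>\<close>, this is the transform of the input
    times the difference of the numerators. It is continuous and not identically zero on the axis,
    so some interval gives a nonzero integral.\<close>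
  define F where "F s = poly (D * (N1 - N2)) (\<i> * complex_of_real s) / (1 + \<i> * complex_of_real s) ^ m" for s
  have "D \<noteq> 0" using D[of 0] by auto
  then obtain s0 where "poly (D * (N1 - N2)) (\<i> * complex_of_real s0) \<noteq> 0"
    using poly_imaginary_axis_nonzero[of "D * (N1 - N2)"] neq by auto
  then have "F s0 \<noteq> 0" by (simp add: F_def one_plus_imaginary_nonzero)
  moreover have "continuous_on UNIV F"
    unfolding F_def by (intro continuous_intros) (simp add: one_plus_imaginary_nonzero)
  ultimately obtain a b where ab: "a \<le> b" and nz: "(\<integral>s. indicator {a..b} s *\<^sub>R F s \<partial>lborel) \<noteq> 0"
    using integral_nonzero_interval by blast
  define \<kappa> where "\<kappa> = (\<integral>s. indicator {a..b} s *\<^sub>R F s \<partial>lborel)"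
  define w where "w = fourier (\<lambda>t. indicator {a..b} t *\<^sub>R poly D (\<i> * complex_of_real t))"
  have w: "in_L2 w" unfolding w_def by (rule poly_window[OF ab])
  \<comment> \<open>The scaling makes the pairing equal to \<open>L2_norm w + 1\<close>. The added 1
    lets the final comparison work without knowing beforehand that \<open>L2_norm w\<close> is
    positive.\<close>
  define \<alpha> where "\<alpha> = complex_of_real (L2_norm w + 1) / \<kappa>"
  have real: "\<exists>f. in_L1 f \<and> in_L2 f \<and> in_L2 (fourier f) \<and>
    (\<forall>s. fourier f s = \<alpha> * poly p (\<i> * complex_of_real s) / (1 + \<i> * complex_of_real s) ^ m)"
    if "degree p < m" for p
    using rational_function_is_fourier[of "Polynomial.smult \<alpha> p" m] that degree_smult_le[of \<alpha> p] by (simp add: mult.assoc)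
  obtain u where u: "in_L1 u" "in_L2 u" "in_L2 (fourier u)"
    and u_hat: "\<And>s. fourier u s = \<alpha> * poly D (\<i> * complex_of_real s) / (1 + \<i> * complex_of_real s) ^ m"
    using real[OF deg(1)] by metis
  have ex: "\<exists>y. is_output \<Sigma> u y"
    if G: "\<And>s. transfer_function \<Sigma> (\<i> * complex_of_real s)
      = poly N (\<i> * complex_of_real s) / poly D (\<i> * complex_of_real s)" and deg: "degree N < m" for \<Sigma> N
  proof -
    obtain y where y: "in_L1 y" "in_L2 y" "in_L2 (fourier y)"
      and y_hat: "\<And>s. fourier y s = \<alpha> * poly N (\<i> * complex_of_real s) / (1 + \<i> * complex_of_real s) ^ m"
      using real[OF deg] by metis
    have "fourier y = (\<lambda>s. transfer_function \<Sigma> (\<i> * complex_of_real s) * fourier u s)"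
      unfolding fun_eq_iff y_hat u_hat G using D by simp
    with is_fourier_L2_fourier[OF y] is_fourier_L2_fourier[OF u] have "is_output \<Sigma> u y"
      unfolding is_output_def by metis
    then show "\<exists>y. is_output \<Sigma> u y" by (rule exI[where x = y])
  qed
  have sep: "1 \<le> L2_norm (\<lambda>t. y1 t - y2 t)"
    if y1: "is_output \<Sigma>1 u y1" and y2: "is_output \<Sigma>2 u y2" for y1 y2
  proof -
    have L2: "in_L2 y1" "in_L2 y2"
      using y1 y2 by (auto simp: is_output_def dest: is_fourier_L2_in_L2)
    have int: "integrable lborel (\<lambda>s. indicator {a..b} s *\<^sub>R (fourier u s * poly N (\<i> * complex_of_real s)))" for N
    proof -
      have "continuous_on {a..b} (\<lambda>s. fourier u s * poly N (\<i> * complex_of_real s))"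
        unfolding u_hat by (intro continuous_intros) (simp add: one_plus_imaginary_nonzero)
      from in_L1_L2_window(1)[OF this] show ?thesis by (simp only: in_L1_def)
    qed
    have "(\<integral>t. (y1 t - y2 t) * w t \<partial>lborel) = (\<integral>t. y1 t * w t \<partial>lborel) - (\<integral>t. y2 t * w t \<partial>lborel)"
      unfolding left_diff_distrib
      by (rule Bochner_Integration.integral_diff[OF integrable_mult_L2[OF L2(1) w] integrable_mult_L2[OF L2(2) w]])
    also have "\<dots> = (\<integral>s. indicator {a..b} s *\<^sub>R (fourier u s * poly N1 (\<i> * complex_of_real s)) \<partial>lborel)
        - (\<integral>s. indicator {a..b} s *\<^sub>R (fourier u s * poly N2 (\<i> * complex_of_real s)) \<partial>lborel)"
      unfolding w_def
      by (rule arg_cong2[where f = minus, OF integral_output_fourier_window[OF G1 D ab u(1) y1]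
            integral_output_fourier_window[OF G2 D ab u(1) y2]])
    also have "\<dots> = (\<integral>s. indicator {a..b} s *\<^sub>R (fourier u s * poly N1 (\<i> * complex_of_real s))
        - indicator {a..b} s *\<^sub>R (fourier u s * poly N2 (\<i> * complex_of_real s)) \<partial>lborel)"
      by (rule Bochner_Integration.integral_diff[OF int int, symmetric])
    also have "\<dots> = (\<integral>s. \<alpha> * (indicator {a..b} s *\<^sub>R F s) \<partial>lborel)"
    proof (rule Bochner_Integration.integral_cong[OF refl])
      fix s
      have "fourier u s * (poly N1 (\<i> * complex_of_real s) - poly N2 (\<i> * complex_of_real s)) = \<alpha> * F s"
        unfolding u_hat F_def poly_mult poly_diff times_divide_eq_left times_divide_eq_right mult.assoc ..
      then show "indicator {a..b} s *\<^sub>R (fourier u s * poly N1 (\<i> * complex_of_real s))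
          - indicator {a..b} s *\<^sub>R (fourier u s * poly N2 (\<i> * complex_of_real s))
          = \<alpha> * (indicator {a..b} s *\<^sub>R F s)"
        unfolding scaleR_diff_right[symmetric] right_diff_distrib[symmetric] mult_scaleR_right
        by (rule arg_cong)
    qed
    also have "\<dots> = \<alpha> * \<kappa>"
      unfolding \<kappa>_def by (rule integral_mult_right_zero)
    also have "\<dots> = complex_of_real (L2_norm w + 1)"
      using nz by (simp add: \<alpha>_def \<kappa>_def)
    finally have "(\<integral>t. (y1 t - y2 t) * w t \<partial>lborel) = complex_of_real (L2_norm w + 1)" .
    from L2_Cauchy_Schwarz[OF in_L2_diff[OF L2] w, unfolded this]
    have "cmod (complex_of_real (L2_norm w + 1)) \<le> L2_norm (\<lambda>t. y1 t - y2 t) * L2_norm w" .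
    then have *: "L2_norm w + 1 \<le> L2_norm (\<lambda>t. y1 t - y2 t) * L2_norm w"
      using L2_norm_nonneg[of w] unfolding norm_of_real by linarith
    \<comment> \<open>No division by \<open>v\<close>: if \<open>x < 1\<close>, then
      \<open>x * v \<le> v\<close>, which contradicts the first assumption.\<close>
    have "1 \<le> x" if "v + 1 \<le> x * v" "0 \<le> v" for x v :: real
      using that mult_right_mono[of x 1 v] by linarith
    from this[OF * L2_norm_nonneg] show ?thesis .
  qed
  have "\<exists>y. is_output \<Sigma>1 u y" "\<exists>y. is_output \<Sigma>2 u y"
    using ex[of \<Sigma>1 N1] ex[of \<Sigma>2 N2] G1 G2 deg by blast+
  with u sep show ?thesis by blast
qed

section \<open>Resolvents of the HiPPO-LegS matrices\<close>

lemma mat_inv_inverse: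
  assumes M: "M \<in> carrier_mat n n" and det: "det M \<noteq> 0"
  shows "mat_inv M \<in> carrier_mat n n" "M * mat_inv M = 1\<^sub>m n" "mat_inv M * M = 1\<^sub>m n"
proof -
  obtain W where "mat_inverse M = Some W"
    using mat_inverse(1)[OF M, where b = undefined] det_non_zero_imp_unit[OF M det, where b = undefined] by auto
  with mat_inverse(2)[OF M this]
  show "mat_inv M \<in> carrier_mat n n" "M * mat_inv M = 1\<^sub>m n" "mat_inv M * M = 1\<^sub>m n"
    by (auto simp: mat_inv_def)
qed

lemma det_nonzero_if_kernel_trivial:
  fixes K :: "'a :: idom mat"
  assumes K: "K \<in> carrier_mat n n"
    and kernel: "\<And>v. v \<in> carrier_vec n \<Longrightarrow> K *\<^sub>v v = 0\<^sub>v n \<Longrightarrow> v = 0\<^sub>v n"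
  shows "det K \<noteq> 0"
  using det_0_iff_vec_prod_zero[OF K] kernel by auto

lemma unitary_det_nonzero:
  assumes "unitary_mat n V"
  shows "det V \<noteq> 0"
proof
  assume "det V = 0"
  moreover have "dim_row (mat_adjoint V * V) = n" "dim_col (V * mat_adjoint V) = n"
    using assms by (simp_all add: unitary_mat_def)
  then have "mat_adjoint V \<in> carrier_mat n n" by auto
  then have "det (mat_adjoint V * V) = det (mat_adjoint V) * det V"
    using assms by (intro det_mult[of _ n]) (auto simp: unitary_mat_def)
  ultimately show False using assms by (simp add: unitary_mat_def)
qed

lemma inverse_mat_cancel_left:
  fixes A :: "'a :: semiring_1 mat"
  assumes "A \<in> carrier_mat n n" "B \<in> carrier_mat n n" "A * B = 1\<^sub>m n" "y \<in> carrier_mat n m"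
  shows "A * (B * y) = y"
  using assoc_mult_mat[OF assms(1,2,4)] left_mult_one_mat[OF assms(4)] assms(3) by metis

text \<open>\<open>mat_inv V * x\<close> solves the conjugated system, after which the left factor
  \<open>V\<close> restores \<open>x\<close>. Knowing one solution of \<open>K * x = b\<close>
  therefore suffices to evaluate the resolvent expression in any coordinates.\<close>

lemma resolvent_similar:
  assumes V: "V \<in> carrier_mat n n" "det V \<noteq> 0"
    and K: "K \<in> carrier_mat n n" "det K \<noteq> 0"
    and x: "x \<in> carrier_mat n m" "K * x = b" and e: "e \<in> carrier_mat r n"
  shows "e * V * mat_inv (mat_inv V * K * V) * (mat_inv V * b) = e * x"
proof -
  note W = mat_inv_inverse[OF V]
  define M where "M = mat_inv V * K * V"
  have M: "M \<in> carrier_mat n n" using V W K by (simp add: M_def)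
  have "det (mat_inv V * V) = det (mat_inv V) * det V"
    using V W by (intro det_mult) auto
  then have "det (mat_inv V) \<noteq> 0" using W by auto
  then have "det M \<noteq> 0"
    using V W K by (simp add: M_def det_mult[of _ n])
  note Mi = mat_inv_inverse[OF M this]
  have Wx: "mat_inv V * x \<in> carrier_mat n m" and b: "b \<in> carrier_mat n m"
    using W x K by auto
  have "M * (mat_inv V * x) = mat_inv V * (K * (V * (mat_inv V * x)))"
    unfolding M_def
    using assoc_mult_mat[OF mult_carrier_mat[OF W(1) K(1)] V(1) Wx]
      assoc_mult_mat[OF W(1) K(1) mult_carrier_mat[OF V(1) Wx]] by metis
  also have "\<dots> = mat_inv V * b"
    using inverse_mat_cancel_left[OF V(1) W(1,2) x(1)] x by simp
  finally have "mat_inv M * (mat_inv V * b) = mat_inv V * x"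
    using inverse_mat_cancel_left[OF Mi(1) M Mi(3) Wx] by simp
  moreover have "mat_inv V * b \<in> carrier_mat n m" using W b by auto
  ultimately have "e * V * mat_inv M * (mat_inv V * b) = e * (V * (mat_inv V * x))"
    using assoc_mult_mat[OF mult_carrier_mat[OF e V(1)] Mi(1), of "mat_inv V * b" m]
      assoc_mult_mat[OF e V(1) Wx] by metis
  then show ?thesis
    using inverse_mat_cancel_left[OF V(1) W(1,2) x(1)] by (simp add: M_def)
qed

text \<open>Serves both systems, with \<open>K\<close> the matrix s I - M in the original
  coordinates, where M is \<open>A_H\<close> or \<open>A_H\<^sup>\<bottom>\<close>, and
  \<open>b\<close> the corresponding input vector. The index \<open>l - 1\<close> converts the
  1-based output index to the 0-based row.\<close>

lemma transfer_function_similar: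
  assumes V: "V \<in> carrier_mat n n" "det V \<noteq> 0"
    and K: "K \<in> carrier_mat n n" "det K \<noteq> 0"
    and x: "x \<in> carrier_mat n 1" "K * x = b" and l: "1 \<le> l" "l \<le> n"
    and A: "sys_A \<Sigma> \<in> carrier_mat n n" "s \<cdot>\<^sub>m 1\<^sub>m n - sys_A \<Sigma> = mat_inv V * K * V"
    and B: "sys_B \<Sigma> = mat_inv V * b" and C: "sys_C \<Sigma> = unit_row n l * V"
  shows "transfer_function \<Sigma> s = x $$ (l - 1, 0) + sys_D \<Sigma>"
proof -
  have e: "unit_row n l \<in> carrier_mat 1 n"
    using mat_of_rows_carrier(1)[of n "[unit_vec n (l - 1)]"] by (simp add: unit_row_def)
  have "transfer_function \<Sigma> s = (unit_row n l * x) $$ (0, 0) + sys_D \<Sigma>"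
    using resolvent_similar[OF V K x e] A by (simp add: transfer_function_def B C)
  also have "(unit_row n l * x) $$ (0, 0) = x $$ (l - 1, 0)"
  proof -
    have "col x 0 \<in> carrier_vec n" "l - 1 < n" using x(1) l by auto
    then show ?thesis using x(1) e by (simp add: unit_row_def scalar_prod_left_unit)
  qed
  finally show ?thesis .
qed

section \<open>The explicit solution of the lower triangular system\<close>

lemma legs_A_carrier: "legs_A n \<in> carrier_mat n n"
  by (simp add: legs_A_def)

definition falling :: "nat \<Rightarrow> complex \<Rightarrow> complex" where
  "falling n s = (\<Prod>k<n. s - of_nat k)"

definition rising :: "nat \<Rightarrow> complex \<Rightarrow> complex" where
  "rising n s = (\<Prod>k<n. s + of_nat (Suc k))"

text \<open>The scalar governing the rank-one update: with \<open>x\<close> the solution for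
  \<open>A_H\<close>, 1 - \<open>B_H\<^sup>T x\<close> is (1 + q) / 2.\<close>

definition legs_q :: "nat \<Rightarrow> complex \<Rightarrow> complex" where
  "legs_q n s = falling n s / rising n s"

text \<open>Apart from the square root, this is the integral of t^s P_i(2 t - 1) over [0, 1] for Re
  s > -1, with P_i the Legendre polynomial: the Mellin-type transform behind the LegS basis.\<close>

definition legs_x :: "nat \<Rightarrow> complex \<Rightarrow> complex" where
  "legs_x i s = of_real (sqrt ((2 * real i + 1) / 2)) * legs_q i s / (s + of_nat (Suc i))"

abbreviation legs_x_mat :: "nat \<Rightarrow> complex \<Rightarrow> complex mat" where
  "legs_x_mat n s \<equiv> mat n 1 (\<lambda>(i, _). legs_x i s)"

context
  fixes s :: complex
  assumes s: "Re s = 0"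
begin

lemma add_Suc_nonzero: "s + of_nat (Suc k) \<noteq> 0"
  using s by (auto simp: complex_eq_iff)

lemma rising_nonzero: "rising n s \<noteq> 0"
  unfolding rising_def using add_Suc_nonzero by (simp del: of_nat_Suc)

lemma legs_q_0: "legs_q 0 s = 1"
  by (simp add: legs_q_def falling_def rising_def)

lemma legs_q_Suc: "legs_q (Suc n) s = legs_q n s * (s - of_nat n) / (s + of_nat (Suc n))"
  by (simp add: legs_q_def falling_def rising_def)

text \<open>Forward substitution in \<open>(s I - A_H) x = B_H\<close> telescopes.\<close>

lemma legs_q_telescope:
  "(\<Sum>k<n. of_nat (2 * k + 1) * (legs_q k s / (s + of_nat (Suc k)))) = 1 - legs_q n s"
proof (induction n)
  case (Suc n)
  \<comment> \<open>The numerators combine because (s + n + 1) - (s - n) = 2 n + 1.\<close>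
  have "of_nat (2 * n + 1) * (legs_q n s / (s + of_nat (Suc n))) = legs_q n s - legs_q (Suc n) s"
    using add_Suc_nonzero[of n] by (simp add: legs_q_Suc field_simps)
  then show ?case unfolding sum.lessThan_Suc Suc.IH by simp
qed (simp add: legs_q_0)

lemma of_real_sqrt_mult_half:
  "complex_of_real (sqrt ((2 * real k + 1) / 2)) * complex_of_real (sqrt ((2 * real k + 1) / 2))
    = of_nat (2 * k + 1) / 2"
proof -
  have "sqrt ((2 * real k + 1) / 2) * sqrt ((2 * real k + 1) / 2) = real (2 * k + 1) / 2"
    by simp
  from arg_cong[OF this, of complex_of_real] show ?thesis
    by (simp only: of_real_mult of_real_divide of_real_of_nat_eq of_real_numeral)
qed

text \<open>The square roots from \<open>B_H\<close> and from \<open>legs_x\<close> multiply to (2 k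
  + 1) / 2, so this is half the telescoping sum. It serves twice: for the partial row sums in
  forward substitution and, with the full size, for the rank-one update.\<close>

lemma legs_B_x_sum:
  "(\<Sum>k<n. complex_of_real (sqrt ((2 * real k + 1) / 2)) * legs_x k s) = (1 - legs_q n s) / 2"
proof -
  have "complex_of_real (sqrt ((2 * real k + 1) / 2)) * legs_x k s
      = of_nat (2 * k + 1) * (legs_q k s / (s + of_nat (Suc k))) / 2" for k
  proof -
    have "b * (b * q / z) = (b * b) * (q / z)" for b q z :: complex by simp
    from this[of "complex_of_real (sqrt ((2 * real k + 1) / 2))"] show ?thesis
      unfolding legs_x_def of_real_sqrt_mult_half by simp
  qed
  then show ?thesis by (simp only: sum_divide_distrib[symmetric] legs_q_telescope)
qed

text \<open>Writing the off-diagonal entries as twice a product of entries of \<open>B_H\<close>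
  lets each row sum be read off from \<open>legs_B_x_sum\<close>.\<close>

lemma cmat_legs_A_resolvent_entry:
  assumes "i < n" "k < n"
  shows "(s \<cdot>\<^sub>m 1\<^sub>m n - cmat (legs_A n)) $$ (i, k) =
    (if k < i then 2 * complex_of_real (sqrt ((2 * real i + 1) / 2)) * complex_of_real (sqrt ((2 * real k + 1) / 2))
     else if i = k then s + of_nat (Suc i) else 0)"
  using assms by (auto simp: legs_A_def real_sqrt_divide simp flip: of_real_mult)

lemma legs_A_resolvent_carrier: "s \<cdot>\<^sub>m 1\<^sub>m n - cmat (legs_A n) \<in> carrier_mat n n"
  using legs_A_carrier by (intro minus_carrier_mat) simp

lemma det_legs_A_resolvent: "det (s \<cdot>\<^sub>m 1\<^sub>m n - cmat (legs_A n)) \<noteq> 0"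
proof -
  let ?K = "s \<cdot>\<^sub>m 1\<^sub>m n - cmat (legs_A n)"
  have "det ?K = prod_list (diag_mat ?K)"
    using legs_A_resolvent_carrier
    by (intro det_lower_triangular[of n]) (auto simp: cmat_legs_A_resolvent_entry)
  moreover have "0 \<notin> set (diag_mat ?K)"
    using legs_A_resolvent_carrier[of n] add_Suc_nonzero
    by (auto simp: diag_mat_def cmat_legs_A_resolvent_entry simp del: of_nat_Suc)
  ultimately show ?thesis by (simp add: prod_list_zero_iff)
qed

lemma legs_A_resolvent_x: "(s \<cdot>\<^sub>m 1\<^sub>m n - cmat (legs_A n)) * legs_x_mat n s = cmat (legs_B n)"
proof (rule eq_matI)
  let ?K = "s \<cdot>\<^sub>m 1\<^sub>m n - cmat (legs_A n)"
  let ?\<beta> = "\<lambda>k. complex_of_real (sqrt ((2 * real k + 1) / 2))"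
  fix i j assume "i < dim_row (cmat (legs_B n))" "j < dim_col (cmat (legs_B n))"
  then have i: "i < n" and j: "j = 0" by (auto simp: legs_B_def)
  have "(?K * legs_x_mat n s) $$ (i, j) = (\<Sum>k<n. ?K $$ (i, k) * legs_x k s)"
    using i j carrier_matD[OF legs_A_resolvent_carrier[of n]] by (simp add: scalar_prod_def atLeast0LessThan)
  also have "\<dots> = (\<Sum>k<n. (if k < i then 2 * ?\<beta> i * (?\<beta> k * legs_x k s) else 0)
      + (if k = i then (s + of_nat (Suc i)) * legs_x i s else 0))"
    by (intro sum.cong) (auto simp: cmat_legs_A_resolvent_entry i mult.assoc)
  also have "\<dots> = (\<Sum>k<i. 2 * ?\<beta> i * (?\<beta> k * legs_x k s)) + (s + of_nat (Suc i)) * legs_x i s"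
  proof -
    have "{..<n} \<inter> {k. k < i} = {..<i}" using i by auto
    then show ?thesis
      using i by (simp add: sum.distrib sum.If_cases)
  qed
  \<comment> \<open>The part below the diagonal gives 1 - q and the diagonal term gives q, so
    \<open>legs_q\<close> cancels in every row.\<close>
  also have "\<dots> = ?\<beta> i * (1 - legs_q i s) + ?\<beta> i * legs_q i s"
  proof -
    have "(\<Sum>k<i. 2 * ?\<beta> i * (?\<beta> k * legs_x k s)) = 2 * ?\<beta> i * ((1 - legs_q i s) / 2)"
      by (simp only: sum_distrib_left[symmetric] legs_B_x_sum)
    moreover have "(s + of_nat (Suc i)) * legs_x i s = ?\<beta> i * legs_q i s"
      using add_Suc_nonzero[of i] by (simp add: legs_x_def del: of_nat_Suc)
    ultimately show ?thesis by simp
  qed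
  also have "\<dots> = cmat (legs_B n) $$ (i, j)"
    using i j by (simp add: legs_B_def algebra_simps)
  finally show "(?K * legs_x_mat n s) $$ (i, j) = cmat (legs_B n) $$ (i, j)" .
qed (auto simp: legs_B_def legs_A_def)

end

section \<open>The rank-one perturbation and its resolvent\<close>

lemma cmat_legs_B_carrier: "cmat (legs_B n) \<in> carrier_mat n 1"
  by (simp add: legs_B_def)

lemma cmat_legs_A_perp:
  "cmat (legs_A_perp n) = cmat (legs_A n) + cmat (legs_B n) * transpose_mat (cmat (legs_B n))"
  by (intro eq_matI) (auto simp: legs_A_perp_def legs_A_def legs_B_def scalar_prod_def)

lemma diff_smult_mat:
  fixes A :: "'a :: ring mat"
  shows "a \<cdot>\<^sub>m A - b \<cdot>\<^sub>m A = (a - b) \<cdot>\<^sub>m A"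
  by (intro eq_matI) (auto simp: left_diff_distrib)

lemma transpose_legs_B_mult:
  assumes "x \<in> carrier_mat n 1"
  shows "transpose_mat (cmat (legs_B n)) * x
    = mat 1 1 (\<lambda>_. \<Sum>k<n. complex_of_real (sqrt ((2 * real k + 1) / 2)) * x $$ (k, 0))"
  using assms by (intro eq_matI) (auto simp: legs_B_def scalar_prod_def atLeast0LessThan intro!: sum.cong)

lemma mult_mat_1_1:
  fixes A :: "complex mat"
  assumes "A \<in> carrier_mat n 1"
  shows "A * mat 1 1 (\<lambda>_. c) = c \<cdot>\<^sub>m A"
  using assms by (intro eq_matI) (auto simp: scalar_prod_def)

lemma legs_A_perp_resolvent_mult:
  assumes x: "x \<in> carrier_mat n 1"
  shows "(s \<cdot>\<^sub>m 1\<^sub>m n - cmat (legs_A_perp n)) * x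
    = (s \<cdot>\<^sub>m 1\<^sub>m n - cmat (legs_A n)) * x
      - (\<Sum>k<n. complex_of_real (sqrt ((2 * real k + 1) / 2)) * x $$ (k, 0)) \<cdot>\<^sub>m cmat (legs_B n)"
proof -
  let ?B = "cmat (legs_B n)" and ?K = "s \<cdot>\<^sub>m 1\<^sub>m n - cmat (legs_A n)"
  have B: "?B \<in> carrier_mat n 1" and A: "cmat (legs_A n) \<in> carrier_mat n n"
    using legs_A_carrier cmat_legs_B_carrier by simp_all
  then have BB: "?B * transpose_mat ?B \<in> carrier_mat n n" and BT: "transpose_mat ?B \<in> carrier_mat 1 n"
    and K: "?K \<in> carrier_mat n n" by auto
  have "s \<cdot>\<^sub>m 1\<^sub>m n - cmat (legs_A_perp n) = ?K - ?B * transpose_mat ?B"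
    unfolding cmat_legs_A_perp using A BB by (intro eq_matI) auto
  then have "(s \<cdot>\<^sub>m 1\<^sub>m n - cmat (legs_A_perp n)) * x = ?K * x - ?B * transpose_mat ?B * x"
    using minus_mult_distrib_mat[OF K BB x] by simp
  also have "?B * transpose_mat ?B * x = ?B * (transpose_mat ?B * x)"
    by (rule assoc_mult_mat[OF B BT x])
  finally show ?thesis
    by (simp only: transpose_legs_B_mult[OF x] mult_mat_1_1[OF B])
qed

context
  fixes s :: complex and n :: nat
  assumes s: "Re s = 0" and q: "1 + legs_q n s \<noteq> 0"
begin

text \<open>The solution for \<open>A_H\<close> only has to be rescaled, because the perturbation
  acts in the direction \<open>B_H\<close>. The right-hand side carries the factor 1 / 2 of the
  input vector of the diagonal system.\<close>

lemma legs_A_perp_resolvent_x: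
  "(s \<cdot>\<^sub>m 1\<^sub>m n - cmat (legs_A_perp n)) * ((1 / (1 + legs_q n s)) \<cdot>\<^sub>m legs_x_mat n s)
    = (1 / 2) \<cdot>\<^sub>m cmat (legs_B n)"
proof -
  let ?X = "(1 / (1 + legs_q n s)) \<cdot>\<^sub>m legs_x_mat n s"
  have X: "?X \<in> carrier_mat n 1" by simp
  have K: "s \<cdot>\<^sub>m 1\<^sub>m n - cmat (legs_A n) \<in> carrier_mat n n" by (rule legs_A_resolvent_carrier[OF s])
  have "(s \<cdot>\<^sub>m 1\<^sub>m n - cmat (legs_A n)) * ?X = (1 / (1 + legs_q n s)) \<cdot>\<^sub>m cmat (legs_B n)"
    using mult_smult_distrib[OF K, of "legs_x_mat n s" 1] legs_A_resolvent_x[OF s, of n] by simp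
  moreover have "(\<Sum>k<n. complex_of_real (sqrt ((2 * real k + 1) / 2)) * ?X $$ (k, 0))
      = (1 - legs_q n s) / 2 / (1 + legs_q n s)"
    unfolding legs_B_x_sum[OF s, symmetric] sum_divide_distrib by (intro sum.cong) auto
  moreover have "1 / (1 + legs_q n s) - (1 - legs_q n s) / 2 / (1 + legs_q n s) = 1 / 2"
  proof -
    \<comment> \<open>Here r stands for 1 + q, so 1 - q becomes 2 - r.\<close>
    have "1 / r - (2 - r) / 2 / r = 1 / 2" if "r \<noteq> 0" for r :: complex
      using that by (simp add: field_simps)
    from this[OF q] show ?thesis by simp
  qed
  ultimately show ?thesis
    by (simp only: legs_A_perp_resolvent_mult[OF X] diff_smult_mat)
qed

text \<open>A kernel vector v satisfies (s I - \<open>A_H\<close>) v = c \<open>B_H\<close> with c =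
  \<open>B_H\<^sup>T v\<close>. Invertibility of the triangular matrix forces v to be c times the
  explicit solution, and pairing with \<open>B_H\<close> again gives c (1 + q) = 0.\<close>

lemma det_legs_A_perp_resolvent: "det (s \<cdot>\<^sub>m 1\<^sub>m n - cmat (legs_A_perp n)) \<noteq> 0"
proof (rule det_nonzero_if_kernel_trivial)
  let ?K = "s \<cdot>\<^sub>m 1\<^sub>m n - cmat (legs_A n)" and ?K' = "s \<cdot>\<^sub>m 1\<^sub>m n - cmat (legs_A_perp n)"
  let ?\<beta> = "\<lambda>k. complex_of_real (sqrt ((2 * real k + 1) / 2))"
  show K': "?K' \<in> carrier_mat n n"
    unfolding cmat_legs_A_perp using cmat_legs_B_carrier[of n] legs_A_carrier[of n] by auto
  have K: "?K \<in> carrier_mat n n" by (rule legs_A_resolvent_carrier[OF s])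
  fix v :: "complex vec"
  assume v: "v \<in> carrier_vec n" and Kv: "?K' *\<^sub>v v = 0\<^sub>v n"
  define x where "x = mat_of_cols n [v]"
  define c where "c = (\<Sum>k<n. ?\<beta> k * v $ k)"
  have x: "x \<in> carrier_mat n 1" and colx: "col x 0 = v"
    using v mat_of_cols_carrier(1)[of n "[v]"] by (auto simp: x_def)
  have xv: "x $$ (k, 0) = v $ k" if "k < n" for k
    using that by (simp add: x_def mat_of_cols_index)
  have c: "(\<Sum>k<n. ?\<beta> k * x $$ (k, 0)) = c"
    unfolding c_def by (intro sum.cong) (auto simp: xv)
  have "?K' * x = 0\<^sub>m n 1"
  proof (rule eq_matI)
    fix i j assume "i < dim_row (0\<^sub>m n 1)" "j < dim_col (0\<^sub>m n 1 :: complex mat)"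
    then show "(?K' * x) $$ (i, j) = 0\<^sub>m n 1 $$ (i, j)"
      using arg_cong[OF Kv, of "\<lambda>w. w $ i"] carrier_matD[OF K'] carrier_matD[OF x] colx
      by simp
  qed (use carrier_matD[OF K'] carrier_matD[OF x] in auto)
  then have z: "?K * x - c \<cdot>\<^sub>m cmat (legs_B n) = 0\<^sub>m n 1"
    using legs_A_perp_resolvent_mult[OF x, of s] c by simp
  have "?K * x = c \<cdot>\<^sub>m cmat (legs_B n)"
  proof (rule eq_matI)
    fix i j assume "i < dim_row (c \<cdot>\<^sub>m cmat (legs_B n))" "j < dim_col (c \<cdot>\<^sub>m cmat (legs_B n))"
    then show "(?K * x) $$ (i, j) = (c \<cdot>\<^sub>m cmat (legs_B n)) $$ (i, j)"
      using arg_cong[OF z, of "\<lambda>w. w $$ (i, j)"] carrier_matD[OF K] carrier_matD[OF x]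
        carrier_matD[OF cmat_legs_B_carrier[of n]] by simp
  qed (use carrier_matD[OF K] carrier_matD[OF x] carrier_matD[OF cmat_legs_B_carrier[of n]] in auto)
  also have "\<dots> = ?K * (c \<cdot>\<^sub>m legs_x_mat n s)"
    using mult_smult_distrib[OF K, of "legs_x_mat n s" 1 c] legs_A_resolvent_x[OF s, of n] by simp
  finally have "?K * x = ?K * (c \<cdot>\<^sub>m legs_x_mat n s)" .
  then have "mat_inv ?K * (?K * x) = mat_inv ?K * (?K * (c \<cdot>\<^sub>m legs_x_mat n s))"
    by (rule arg_cong)
  moreover note Ki = mat_inv_inverse[OF K det_legs_A_resolvent[OF s]]
  ultimately have xc: "x = c \<cdot>\<^sub>m legs_x_mat n s"
    using inverse_mat_cancel_left[OF Ki(1) K Ki(3) x]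
      inverse_mat_cancel_left[OF Ki(1) K Ki(3), of "c \<cdot>\<^sub>m legs_x_mat n s" 1] by simp
  then have vc: "v $ k = c * legs_x k s" if "k < n" for k
    using xv[OF that] that by simp
  have "(\<Sum>k<n. ?\<beta> k * v $ k) = (\<Sum>k<n. c * (?\<beta> k * legs_x k s))"
    by (intro sum.cong) (auto simp: vc)
  with c_def have "c = (\<Sum>k<n. c * (?\<beta> k * legs_x k s))" by (rule trans)
  also have "\<dots> = c * ((1 - legs_q n s) / 2)"
    by (simp only: sum_distrib_left[symmetric] legs_B_x_sum[OF s])
  finally have "c * (1 + legs_q n s) = 0" by (simp add: field_simps)
  then have "c = 0" using q by simp
  then show "v = 0\<^sub>v n" using v vc by (intro eq_vecI) auto
qed

end

section \<open>The two transfer functions on the imaginary axis\<close>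

lemma conjugated_resolvent:
  fixes M :: "complex mat"
  assumes W: "W \<in> carrier_mat n n" and V: "V \<in> carrier_mat n n" and M: "M \<in> carrier_mat n n"
    and WV: "W * V = 1\<^sub>m n"
  shows "W * (s \<cdot>\<^sub>m 1\<^sub>m n - M) * V = s \<cdot>\<^sub>m 1\<^sub>m n - W * M * V"
proof -
  have I: "s \<cdot>\<^sub>m 1\<^sub>m n \<in> carrier_mat n n" by simp
  have "W * (s \<cdot>\<^sub>m 1\<^sub>m n - M) * V = W * (s \<cdot>\<^sub>m 1\<^sub>m n) * V - W * M * V"
    using mult_minus_distrib_mat[OF W I M]
      minus_mult_distrib_mat[OF mult_carrier_mat[OF W I] mult_carrier_mat[OF W M] V] by simp
  also have "W * (s \<cdot>\<^sub>m 1\<^sub>m n) = s \<cdot>\<^sub>m W"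
    using mult_smult_distrib[OF W, of "1\<^sub>m n" n s] W by simp
  also have "s \<cdot>\<^sub>m W * V = s \<cdot>\<^sub>m 1\<^sub>m n"
    using mult_smult_assoc_mat[OF W V] WV by simp
  finally show ?thesis .
qed

context
  fixes l n :: nat and V \<Lambda> :: "complex mat"
  assumes l: "1 \<le> l" "l \<le> n"
    and diag: "unitary_diagonalization n (cmat (legs_A_perp n)) V \<Lambda>"
begin

lemma diagonalizer_carrier: "V \<in> carrier_mat n n" and det_diagonalizer: "det V \<noteq> 0" and diagonal_carrier: "\<Lambda> \<in> carrier_mat n n"
  and diagonalization: "cmat (legs_A_perp n) = V * \<Lambda> * mat_inv V"
  using diag unitary_det_nonzero by (auto simp: unitary_diagonalization_def unitary_mat_def)

lemmas diagonalizer_inv = mat_inv_inverse[OF diagonalizer_carrier det_diagonalizer]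

lemma conjugate_legs_A_perp: "mat_inv V * cmat (legs_A_perp n) * V = \<Lambda>"
proof -
  note C = diagonalizer_carrier diagonal_carrier diagonalizer_inv
  have "mat_inv V * (V * \<Lambda> * mat_inv V) = \<Lambda> * mat_inv V"
    using assoc_mult_mat[OF C(1,2,3)] inverse_mat_cancel_left[OF C(3,1,5) mult_carrier_mat[OF C(2,3)]]
    by simp
  then have "mat_inv V * cmat (legs_A_perp n) * V = \<Lambda> * mat_inv V * V"
    by (simp add: diagonalization)
  also have "\<dots> = \<Lambda>"
    using assoc_mult_mat[OF C(2,3,1)] C by simp
  finally show ?thesis .
qed

text \<open>Subtracting the conjugated rank-one term from \<open>\<Lambda>\<close> undoes the
  perturbation, so the state matrix is the conjugate of \<open>A_H\<close> and the triangular
  solution applies.\<close>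

lemma transfer_function_DPLR:
  assumes s: "Re s = 0"
  shows "transfer_function (DPLR_system l n V \<Lambda> d) s = legs_x (l - 1) s + d"
proof -
  let ?B = "cmat (legs_B n)" and ?W = "mat_inv V"
  have B: "?B \<in> carrier_mat n 1" by (rule cmat_legs_B_carrier)
  then have BT: "transpose_mat ?B \<in> carrier_mat 1 n" by simp
  have A: "cmat (legs_A n) \<in> carrier_mat n n" using legs_A_carrier by simp
  note BB = mult_carrier_mat[OF B BT]
  have "?W * cmat (legs_A_perp n) = ?W * cmat (legs_A n) + ?W * (?B * transpose_mat ?B)"
    unfolding cmat_legs_A_perp by (rule mult_add_distrib_mat[OF diagonalizer_inv(1) A BB])
  then have "\<Lambda> = ?W * cmat (legs_A n) * V + ?W * (?B * transpose_mat ?B) * V"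
    using conjugate_legs_A_perp add_mult_distrib_mat[OF mult_carrier_mat[OF diagonalizer_inv(1) A] mult_carrier_mat[OF diagonalizer_inv(1) BB] diagonalizer_carrier]
    by simp
  moreover have "?W * (?B * transpose_mat ?B) = ?W * ?B * transpose_mat ?B"
    by (rule assoc_mult_mat[OF diagonalizer_inv(1) B BT, symmetric])
  moreover have R: "?W * ?B * transpose_mat ?B * V \<in> carrier_mat n n"
    using diagonalizer_inv(1) B BT diagonalizer_carrier by auto
  moreover have "?W * cmat (legs_A n) * V \<in> carrier_mat n n"
    using diagonalizer_inv(1) A diagonalizer_carrier by auto
  ultimately have eq: "\<Lambda> - ?W * ?B * transpose_mat ?B * V = ?W * cmat (legs_A n) * V"
    by (intro eq_matI) auto
  have "transfer_function (DPLR_system l n V \<Lambda> d) s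
      = legs_x_mat n s $$ (l - 1, 0) + sys_D (DPLR_system l n V \<Lambda> d)"
  proof (rule transfer_function_similar[OF diagonalizer_carrier det_diagonalizer legs_A_resolvent_carrier[OF s]
        det_legs_A_resolvent[OF s] _ legs_A_resolvent_x[OF s] l])
    show "sys_A (DPLR_system l n V \<Lambda> d) \<in> carrier_mat n n"
      using minus_carrier_mat[OF R] by (simp add: DPLR_system_def)
    show "s \<cdot>\<^sub>m 1\<^sub>m n - sys_A (DPLR_system l n V \<Lambda> d) = ?W * (s \<cdot>\<^sub>m 1\<^sub>m n - cmat (legs_A n)) * V"
      by (simp add: DPLR_system_def eq conjugated_resolvent[OF diagonalizer_inv(1) diagonalizer_carrier A diagonalizer_inv(3)])
  qed (simp_all add: DPLR_system_def)
  then show ?thesis using l by (simp add: DPLR_system_def)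
qed

lemma transfer_function_Diag:
  assumes s: "Re s = 0" and q: "1 + legs_q n s \<noteq> 0"
  shows "transfer_function (Diag_system l n V \<Lambda> d) s = legs_x (l - 1) s / (1 + legs_q n s) + d"
proof -
  have A: "cmat (legs_A_perp n) \<in> carrier_mat n n"
    using diagonalization diagonalizer_carrier diagonal_carrier diagonalizer_inv(1) by auto
  have K: "s \<cdot>\<^sub>m 1\<^sub>m n - cmat (legs_A_perp n) \<in> carrier_mat n n"
    by (rule minus_carrier_mat[OF A])
  have X: "(1 / (1 + legs_q n s)) \<cdot>\<^sub>m legs_x_mat n s \<in> carrier_mat n 1" by simp
  have "transfer_function (Diag_system l n V \<Lambda> d) s
      = ((1 / (1 + legs_q n s)) \<cdot>\<^sub>m legs_x_mat n s) $$ (l - 1, 0) + sys_D (Diag_system l n V \<Lambda> d)"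
  proof (rule transfer_function_similar[OF diagonalizer_carrier det_diagonalizer K
        det_legs_A_perp_resolvent[OF s q] X legs_A_perp_resolvent_x[OF s q] l])
    show "sys_A (Diag_system l n V \<Lambda> d) \<in> carrier_mat n n"
      using diagonal_carrier by (simp add: Diag_system_def)
    show "s \<cdot>\<^sub>m 1\<^sub>m n - sys_A (Diag_system l n V \<Lambda> d) = mat_inv V * (s \<cdot>\<^sub>m 1\<^sub>m n - cmat (legs_A_perp n)) * V"
      by (simp add: Diag_system_def conjugated_resolvent[OF diagonalizer_inv(1) diagonalizer_carrier A diagonalizer_inv(3)] conjugate_legs_A_perp)
    show "sys_B (Diag_system l n V \<Lambda> d) = mat_inv V * ((1 / 2) \<cdot>\<^sub>m cmat (legs_B n))"
      using mult_smult_distrib[OF diagonalizer_inv(1) cmat_legs_B_carrier] by (simp add: Diag_system_def)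
  qed (simp add: Diag_system_def)
  then show ?thesis using l by (simp add: Diag_system_def)
qed

end

section \<open>The modulus of \<open>legs_q\<close> on the imaginary axis\<close>

lemma legs_q_Suc_eq:
  "legs_q (Suc m) s = s / (s + of_nat (Suc m)) * (\<Prod>k<m. (s - of_nat (Suc k)) / (s + of_nat (Suc k)))"
proof -
  have "falling (Suc m) s = s * (\<Prod>k<m. s - of_nat (Suc k))"
    unfolding falling_def prod.lessThan_Suc_shift by simp
  moreover have "rising (Suc m) s = (\<Prod>k<m. s + of_nat (Suc k)) * (s + of_nat (Suc m))"
    by (simp add: rising_def)
  ultimately show ?thesis by (simp add: legs_q_def prod_dividef)
qed

text \<open>After the index shift of \<open>legs_q_Suc_eq\<close>, each factor s - k stands over s +
  k, and these have equal modulus on the axis. Only the unpaired s in the numerator and s + n in the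
  denominator remain.\<close>

lemma norm_legs_q_imaginary:
  assumes "0 < n"
  shows "cmod (legs_q n (\<i> * of_real w)) = \<bar>w\<bar> / cmod (\<i> * of_real w + of_nat n)"
proof -
  obtain m where n: "n = Suc m" using assms by (cases n) auto
  let ?s = "\<i> * complex_of_real w"
  have "cmod ((?s - of_nat (Suc k)) / (?s + of_nat (Suc k))) = 1" for k
  proof -
    have "?s + of_nat (Suc k) \<noteq> 0" by (rule add_Suc_nonzero) simp
    moreover have "cmod (?s - of_nat (Suc k)) = cmod (?s + of_nat (Suc k))"
      by (simp add: cmod_def del: of_nat_Suc)
    ultimately show ?thesis by (simp add: norm_divide del: of_nat_Suc)
  qed
  then show ?thesis
    unfolding n legs_q_Suc_eq by (simp add: norm_mult norm_divide prod_norm[symmetric] del: of_nat_Suc)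
qed

lemma one_plus_legs_q_nonzero:
  assumes "0 < n"
  shows "1 + legs_q n (\<i> * of_real w) \<noteq> 0"
proof
  assume "1 + legs_q n (\<i> * of_real w) = 0"
  then have "legs_q n (\<i> * of_real w) = -1" by (simp add: add_eq_0_iff)
  then have "cmod (legs_q n (\<i> * of_real w)) = 1" by simp
  moreover have "\<bar>w\<bar> < cmod (\<i> * of_real w + of_nat n)"
    unfolding cmod_def using assms by (intro real_less_rsqrt) simp
  ultimately show False using norm_legs_q_imaginary[OF assms, of w] by (simp add: divide_simps split: if_splits)
qed

section \<open>The gap on the imaginary axis\<close>

lemma cmod_imaginary_plus_nat: "cmod (\<i> * of_real w + of_nat n) = sqrt (w\<^sup>2 + (real n)\<^sup>2)"
  by (simp add: cmod_def add.commute)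

lemma Complex_eq_cis_arctan:
  assumes "0 < w"
  shows "Complex w y = of_real (sqrt (w\<^sup>2 + y\<^sup>2)) * cis (arctan (y / w))"
proof -
  have R: "sqrt (w\<^sup>2 + y\<^sup>2) = w * sqrt (1 + (y / w)\<^sup>2)"
  proof -
    have "w\<^sup>2 + y\<^sup>2 = w\<^sup>2 * (1 + (y / w)\<^sup>2)" using assms by (simp add: field_simps)
    then show ?thesis using assms by (simp add: real_sqrt_mult)
  qed
  have "sqrt (1 + (y / w)\<^sup>2) \<noteq> 0" by (simp add: add_nonneg_eq_0_iff)
  then show ?thesis
    using assms unfolding R complex_eq_iff by (simp add: cos_arctan sin_arctan)
qed

text \<open>After removing a common factor i, numerator and denominator are the conjugates w + i k
  and w - i k, so the quotient has modulus 1 and twice the angle. The unpaired factor in the next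
  lemma contributes its angle once.\<close>

lemma quotient_eq_cis_arctan:
  assumes "0 < w"
  shows "(\<i> * of_real w - of_nat k) / (\<i> * of_real w + of_nat k) = cis (2 * arctan (real k / w))"
proof -
  let ?R = "complex_of_real (sqrt (w\<^sup>2 + (real k)\<^sup>2))" and ?\<theta> = "arctan (real k / w)"
  have "sqrt (w\<^sup>2 + (real k)\<^sup>2) > 0" using assms by (simp add: add_pos_nonneg)
  then have R: "?R \<noteq> 0" unfolding of_real_eq_0_iff by (rule less_imp_neq[symmetric])
  have "\<i> * of_real w - of_nat k = \<i> * Complex w (real k)" by (simp add: complex_eq_iff)
  also have "\<dots> = \<i> * (?R * cis ?\<theta>)" by (simp only: Complex_eq_cis_arctan[OF assms])
  finally have num: "\<i> * of_real w - of_nat k = \<i> * (?R * cis ?\<theta>)" .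
  have "\<i> * of_real w + of_nat k = \<i> * Complex w (- real k)" by (simp add: complex_eq_iff)
  also have "\<dots> = \<i> * (?R * cis (- ?\<theta>))"
    using Complex_eq_cis_arctan[OF assms, of "- real k"] by (simp add: arctan_minus)
  finally have den: "\<i> * of_real w + of_nat k = \<i> * (?R * cis (- ?\<theta>))" .
  show ?thesis unfolding num den using R by (simp add: cis_divide)
qed

lemma imaginary_quotient_eq_cis_arctan:
  assumes "0 < w"
  shows "\<i> * of_real w / (\<i> * of_real w + of_nat k)
    = of_real (w / sqrt (w\<^sup>2 + (real k)\<^sup>2)) * cis (arctan (real k / w))"
proof -
  let ?R = "complex_of_real (sqrt (w\<^sup>2 + (real k)\<^sup>2))" and ?\<theta> = "arctan (real k / w)"
  have "\<i> * of_real w + of_nat k = \<i> * Complex w (- real k)" by (simp add: complex_eq_iff)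
  also have "\<dots> = \<i> * (?R * cis (- ?\<theta>))"
    using Complex_eq_cis_arctan[OF assms, of "- real k"] by (simp add: arctan_minus)
  finally have den: "\<i> * of_real w + of_nat k = \<i> * (?R * cis (- ?\<theta>))" .
  have "\<i> * x / (\<i> * (r * c)) = x / r * inverse c" for x r c :: complex
  proof -
    have "\<i> * x / (\<i> * (r * c)) = x / (r * c)" by simp
    then show ?thesis by (simp add: divide_inverse)
  qed
  then show ?thesis unfolding den by (simp only: cis_inverse of_real_divide minus_minus)
qed

text \<open>A continuous branch for \<open>w > 0\<close> of the argument of
  \<open>legs_q (Suc m)\<close> at i w, not reduced modulo 2 \<open>pi\<close>, so that the
  intermediate value theorem applies.\<close>

definition legs_phase :: "nat \<Rightarrow> real \<Rightarrow> real" where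
  "legs_phase m w = arctan (real (Suc m) / w) + (\<Sum>k<m. 2 * arctan (real (Suc k) / w))"

lemma prod_cis: "finite A \<Longrightarrow> (\<Prod>k\<in>A. cis (f k)) = cis (\<Sum>k\<in>A. f k)"
  by (induction rule: finite_induct) (auto simp: cis_mult)

lemma legs_q_polar:
  assumes "0 < w"
  shows "legs_q (Suc m) (\<i> * of_real w)
    = of_real (w / sqrt (w\<^sup>2 + (real (Suc m))\<^sup>2)) * cis (legs_phase m w)"
  unfolding legs_q_Suc_eq imaginary_quotient_eq_cis_arctan[OF assms] quotient_eq_cis_arctan[OF assms]
    legs_phase_def
  by (simp add: prod_cis cis_mult mult.assoc del: of_nat_Suc)

text \<open>On [0, 1] the derivative of arctan is at least 1 / 2.\<close>

lemma le_2_arctan: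
  assumes "0 \<le> y" "y \<le> 1"
  shows "y \<le> 2 * arctan y"
proof -
  have "arctan 0 - 0 / 2 \<le> arctan y - y / 2"
  proof (rule DERIV_nonneg_imp_nondecreasing[OF assms(1)])
    fix x assume "0 \<le> x" "x \<le> y"
    then have x2: "x\<^sup>2 \<le> 1" using assms by (simp add: power_le_one)
    have "((\<lambda>x. arctan x - x / 2) has_real_derivative inverse (1 + x\<^sup>2) - 1 / 2) (at x)"
      by (auto intro!: derivative_eq_intros)
    moreover have "0 \<le> inverse (1 + x\<^sup>2) - 1 / 2"
    proof -
      have "inverse 2 \<le> inverse (1 + x\<^sup>2)" using x2 by (intro le_imp_inverse_le) (auto simp: add_pos_nonneg)
      then show ?thesis by simp
    qed
    ultimately show "\<exists>d. ((\<lambda>x. arctan x - x / 2) has_real_derivative d) (at x) \<and> 0 \<le> d" by blast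
  qed
  then show ?thesis by simp
qed

lemma sum_real_Suc: "(\<Sum>k<m. real (Suc k)) = real m * (real m + 1) / 2"
  by (induction m) (auto simp: field_simps)

text \<open>The phase decreases from about \<open>n\<pi>\<close> to 0 and behaves like \<open>n\<^sup>2 / w\<close> for large \<open>w\<close>,
  so it crosses \<open>\<pi>\<close> at some \<open>w\<close> of order \<open>n\<^sup>2\<close>.\<close>

lemma legs_phase_eq_pi:
  assumes "16 \<le> Suc m"
  shows "\<exists>w. (real (Suc m))\<^sup>2 / 16 \<le> w \<and> legs_phase m w = pi"
proof -
  define n where "n = real (Suc m)"
  have n: "16 \<le> n" "real m = n - 1" using assms by (auto simp: n_def)
  have w0: "0 < n\<^sup>2 / 16" using n by simp
  \<comment> \<open>This is where 16 enters: every ratio k / w at w = n^2 / 16 stays at most 1, the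
    range of \<open>le_2_arctan\<close>.\<close>
  have "n * 16 \<le> n * n" using n by (intro mult_left_mono) auto
  then have n2: "n \<le> n\<^sup>2 / 16" by (simp add: power2_eq_square)
  have low: "pi \<le> legs_phase m (n\<^sup>2 / 16)"
  proof -
    have half: "real (Suc k) / (n\<^sup>2 / 16) \<le> 2 * arctan (real (Suc k) / (n\<^sup>2 / 16))" if "k < m" for k
    proof -
      have "real (Suc k) \<le> n\<^sup>2 / 16" using that n n2 by linarith
      then have "real (Suc k) / (n\<^sup>2 / 16) \<le> 1" using w0 by (subst divide_le_eq_1_pos) auto
      moreover have "0 \<le> real (Suc k) / (n\<^sup>2 / 16)" using w0 by (intro divide_nonneg_pos) auto
      ultimately show ?thesis by (rule le_2_arctan[rotated])
    qed
    \<comment> \<open>The paired angles alone contribute at least the sum of the ratios, which is 8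
      (n - 1) / n and hence at least 7.\<close>
    have "pi \<le> 7" using pi_less_4 by simp
    also have "\<dots> \<le> (n - 1) * n / 2 / (n\<^sup>2 / 16)"
    proof -
      have "7 * n \<le> 8 * (n - 1)" using n by simp
      then have "7 * n * n \<le> 8 * (n - 1) * n" using n by (intro mult_right_mono) auto
      then show ?thesis using n by (simp add: field_simps power2_eq_square)
    qed
    also have "\<dots> = (\<Sum>k<m. real (Suc k) / (n\<^sup>2 / 16))"
      unfolding sum_divide_distrib[symmetric] sum_real_Suc n(2) by simp
    also have "\<dots> \<le> (\<Sum>k<m. 2 * arctan (real (Suc k) / (n\<^sup>2 / 16)))"
      by (intro sum_mono half) auto
    also have "\<dots> \<le> legs_phase m (n\<^sup>2 / 16)"
      unfolding legs_phase_def using w0 by (simp add: zero_le_arctan_iff)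
    finally show ?thesis .
  qed
  \<comment> \<open>At w = n^2 the bound of arctan by its argument gives 1 / n + (n - 1) / n =
    1.\<close>
  have high: "legs_phase m (n\<^sup>2) \<le> pi"
  proof -
    have "legs_phase m (n\<^sup>2) \<le> real (Suc m) / n\<^sup>2 + (\<Sum>k<m. 2 * (real (Suc k) / n\<^sup>2))"
      unfolding legs_phase_def
      by (intro add_mono sum_mono mult_left_mono arctan_le_self) auto
    also have "\<dots> = n / n\<^sup>2 + 2 * ((n - 1) * n / 2 / n\<^sup>2)"
      unfolding sum_distrib_left[symmetric] sum_divide_distrib[symmetric] sum_real_Suc n(2)
      by (simp add: n_def)
    also have "\<dots> = 1" using n by (simp add: field_simps power2_eq_square)
    also have "\<dots> \<le> pi" using pi_gt3 by simp
    finally show ?thesis .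
  qed
  have "\<exists>w\<ge>n\<^sup>2 / 16. w \<le> n\<^sup>2 \<and> legs_phase m w = pi"
  proof (rule IVT2'[of "legs_phase m" "n\<^sup>2" pi "n\<^sup>2 / 16", OF high low])
    show "continuous_on {n\<^sup>2 / 16..n\<^sup>2} (legs_phase m)"
      unfolding legs_phase_def using w0 by (intro continuous_intros) auto
  qed simp
  then show ?thesis by (auto simp: n_def)
qed

text \<open>For w at least j + 1, the relevant moduli |i w + k| are at most sqrt 2 times w. Thus the
  square root and \<open>legs_q\<close> each contribute at least 1 / sqrt 2, and only the last
  denominator costs a factor of order w.\<close>

lemma norm_legs_x_ge:
  assumes "real (Suc j) \<le> w"
  shows "1 / (4 * w) \<le> cmod (legs_x j (\<i> * of_real w))"
proof -
  have w: "0 < w" using assms by (simp add: add_pos_nonneg order_less_le_trans[OF _ assms])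
  let ?c = "\<lambda>k. cmod (\<i> * of_real w + of_nat k)"
  have c: "?c k \<le> sqrt 2 * w" if "k \<le> Suc j" for k
  proof -
    have "(real k)\<^sup>2 \<le> w\<^sup>2" using that assms by (intro power_mono) auto
    then have "sqrt (w\<^sup>2 + (real k)\<^sup>2) \<le> sqrt (2 * w\<^sup>2)" by simp
    also have "\<dots> = sqrt 2 * w" using w by (simp add: real_sqrt_mult)
    finally show ?thesis unfolding cmod_imaginary_plus_nat .
  qed
  have pos: "0 < ?c k" for k
    unfolding cmod_imaginary_plus_nat using w by (simp add: add_pos_nonneg)
  have q: "1 / sqrt 2 \<le> cmod (legs_q j (\<i> * of_real w))"
  proof (cases "j = 0")
    case True
    then show ?thesis by (simp add: legs_q_0)
  next
    case False
    have "1 / sqrt 2 = w / (sqrt 2 * w)" using w by simp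
    also have "\<dots> \<le> w / ?c j" using c[of j] pos[of j] w by (intro divide_left_mono) auto
    finally show ?thesis using norm_legs_q_imaginary[of j w] False w by simp
  qed
  have b: "1 / sqrt 2 \<le> sqrt ((2 * real j + 1) / 2)"
    by (simp add: real_sqrt_divide divide_right_mono)
  have "1 / (4 * w) \<le> 1 / 2 / (sqrt 2 * w)"
  proof -
    have "sqrt 2 \<le> 2" by (rule real_le_lsqrt) auto
    then show ?thesis using w by (simp add: field_simps)
  qed
  also have "1 / 2 = (1 / sqrt 2) * (1 / sqrt (2::real))" by simp
  also have "(1 / sqrt 2) * (1 / sqrt 2) / (sqrt 2 * w)
      \<le> sqrt ((2 * real j + 1) / 2) * cmod (legs_q j (\<i> * of_real w)) / ?c (Suc j)"
    using w pos[of "Suc j"] by (intro frac_le mult_mono b q c) auto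
  also have "\<dots> = cmod (legs_x j (\<i> * of_real w))"
    by (simp add: legs_x_def norm_mult norm_divide del: of_nat_Suc)
  finally show ?thesis .
qed

text \<open>Where the phase is \<open>pi\<close>, q is the negative real number - w / R, so |q / (1
  + q)| = w / (R - w). Its growth of order w compensates the decay of \<open>legs_x\<close>, and the
  resulting bound does not depend on n.\<close>

lemma transfer_gap_lower_bound:
  assumes n: "16 \<le> n" and j: "j < n"
  shows "\<exists>w. 1 / 64 \<le> cmod (legs_x j (\<i> * of_real w) - legs_x j (\<i> * of_real w) / (1 + legs_q n (\<i> * of_real w)))"
proof -
  obtain m where m: "n = Suc m" using n by (cases n) auto
  obtain w where w: "(real n)\<^sup>2 / 16 \<le> w" and phase: "legs_phase m w = pi"
    using legs_phase_eq_pi[of m] n m by auto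
  let ?s = "\<i> * complex_of_real w"
  have "real n * 16 \<le> real n * real n" using n by (intro mult_left_mono) auto
  then have nw: "real n \<le> w" using w by (simp add: power2_eq_square)
  then have w0: "0 < w" using n by linarith
  define R where "R = sqrt (w\<^sup>2 + (real n)\<^sup>2)"
  have Rw: "w < R" unfolding R_def using w0 n by (intro real_less_rsqrt) simp
  have R2: "R\<^sup>2 = w\<^sup>2 + (real n)\<^sup>2" unfolding R_def by simp
  have q: "legs_q n ?s = - of_real (w / R)"
    using legs_q_polar[OF w0, of m] phase by (simp add: m R_def)
  have "legs_x j ?s - legs_x j ?s / (1 + legs_q n ?s) = - (legs_x j ?s * of_real (w / (R - w)))"
  proof -
    have "1 - 1 / (1 - w / R) = - (w / (R - w))"
      using Rw w0 by (simp add: field_simps)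
    then have "1 - 1 / (1 - complex_of_real (w / R)) = - complex_of_real (w / (R - w))"
      by (metis of_real_1 of_real_diff of_real_divide of_real_minus)
    then have "legs_x j ?s * (1 - 1 / (1 - complex_of_real (w / R))) = legs_x j ?s * - complex_of_real (w / (R - w))"
      by (rule arg_cong)
    then show ?thesis unfolding q by (simp add: right_diff_distrib)
  qed
  then have eq: "cmod (legs_x j ?s - legs_x j ?s / (1 + legs_q n ?s)) = cmod (legs_x j ?s) * (w / (R - w))"
    using Rw w0 by (simp only: norm_minus_cancel norm_mult norm_of_real abs_of_nonneg divide_nonneg_pos
        less_imp_le diff_gt_0_iff_gt)
  \<comment> \<open>The difference of squares R^2 - w^2 is n^2, which is at most 16 w by the choice
    of w.\<close>
  have "(R - w) * (2 * w) \<le> (R - w) * (R + w)" using Rw by (intro mult_left_mono) auto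
  also have "\<dots> = (real n)\<^sup>2" using R2 by (simp add: algebra_simps power2_eq_square)
  also have "\<dots> \<le> 16 * w" using w by simp
  finally have "R - w \<le> 8" using w0 by simp
  \<comment> \<open>The factors w cancel, leaving 1 / (4 (R - w)), already at least 1 / 32.\<close>
  have "1 / 64 \<le> 1 / (4 * w) * (w / (R - w))"
  proof -
    have "1 / (4 * w) * (w / (R - w)) = 1 / (4 * (R - w))" using w0 by simp
    moreover have "1 / 64 \<le> 1 / (4 * (R - w))"
      using Rw \<open>R - w \<le> 8\<close> by (intro frac_le) auto
    ultimately show ?thesis by simp
  qed
  also have "\<dots> \<le> cmod (legs_x j ?s) * (w / (R - w))"
    using norm_legs_x_ge[of j w] j nw Rw w0 by (intro mult_right_mono) auto
  finally show ?thesis unfolding eq[symmetric] by blast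
qed

section \<open>Polynomial forms of the transfer functions, and the conclusion\<close>

lemma transfer_functions_common_denominator:
  assumes n: "0 < n"
  shows "\<exists>D N1 N2 :: complex poly. N1 \<noteq> N2 \<and> (\<forall>w. poly D (\<i> * of_real w) \<noteq> 0) \<and>
    (\<forall>w. legs_x j (\<i> * of_real w) + d = poly N1 (\<i> * of_real w) / poly D (\<i> * of_real w)) \<and>
    (\<forall>w. legs_x j (\<i> * of_real w) / (1 + legs_q n (\<i> * of_real w)) + d
       = poly N2 (\<i> * of_real w) / poly D (\<i> * of_real w))"
proof -
  define F :: "nat \<Rightarrow> complex poly" where "F n = (\<Prod>k<n. [:- of_nat k, 1:])" for n
  define R :: "nat \<Rightarrow> complex poly" where "R n = (\<Prod>k<n. [:of_nat (Suc k), 1:])" for n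
  have F: "poly (F n) s = falling n s" for n s
    by (simp add: F_def falling_def poly_prod)
  have R: "poly (R n) s = rising n s" for n s
    by (simp add: R_def rising_def poly_prod add.commute add.left_commute)
  define b where "b = complex_of_real (sqrt ((2 * real j + 1) / 2))"
  \<comment> \<open>Since 1 + q is (F n + R n) / R n, dividing by it moves F n + R n into the
    denominator. On the axis neither factor of \<open>D\<close> vanishes: the roots of
    \<open>R\<close> are negative integers, and 1 + q has no zero there.\<close>
  define D where "D = R (Suc j) * (F n + R n)"
  define N1 where "N1 = [:b:] * F j * (F n + R n) + [:d:] * D"
  define N2 where "N2 = [:b:] * F j * R n + [:d:] * D"
  have "b \<noteq> 0" by (simp add: b_def)
  moreover have "F n \<noteq> 0" for n by (simp add: F_def)
  \<comment> \<open>The terms containing \<open>d\<close> and \<open>R n\<close> cancel, leaving a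
    product of nonzero polynomials.\<close>
  moreover have "N1 - N2 = [:b:] * F j * F n" by (simp add: N1_def N2_def algebra_simps)
  ultimately have "N1 \<noteq> N2" by auto
  have r: "rising n (\<i> * of_real w) \<noteq> 0" for n w by (rule rising_nonzero) simp
  have sum: "falling n (\<i> * of_real w) + rising n (\<i> * of_real w) \<noteq> 0" for w
    using one_plus_legs_q_nonzero[OF n, of w] r[of n w]
    by (simp add: legs_q_def field_simps)
  have x: "legs_x j s = b * falling j s / rising (Suc j) s" for s
    by (simp add: legs_x_def b_def legs_q_def rising_def)
  have "poly D (\<i> * of_real w) \<noteq> 0" for w
    using r[of "Suc j" w] sum[of w] by (simp add: D_def F R)
  moreover have "legs_x j (\<i> * of_real w) + d = poly N1 (\<i> * of_real w) / poly D (\<i> * of_real w)" for w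
  proof -
    have "b * X / r + d = (b * X * S + d * (r * S)) / (r * S)" if "r \<noteq> 0" "S \<noteq> 0" for X r S
      using that by (simp add: add_divide_distrib)
    from this[OF r[of "Suc j" w] sum[of w], of "falling j (\<i> * of_real w)"] show ?thesis
      by (simp add: x N1_def D_def F R)
  qed
  moreover have "legs_x j (\<i> * of_real w) / (1 + legs_q n (\<i> * of_real w)) + d
       = poly N2 (\<i> * of_real w) / poly D (\<i> * of_real w)" for w
  proof -
    have "1 + legs_q n (\<i> * of_real w) = (falling n (\<i> * of_real w) + rising n (\<i> * of_real w)) / rising n (\<i> * of_real w)"
      using r[of n w] by (simp add: legs_q_def field_simps)
    moreover have "b * X / r / (S / T) + d = (b * X * T + d * (r * S)) / (r * S)"
      if "r \<noteq> 0" "S \<noteq> 0" "T \<noteq> 0" for X r S T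
      using that by (simp add: add_divide_distrib)
    from this[OF r[of "Suc j" w] sum[of w] r[of n w], of "falling j (\<i> * of_real w)"]
    have "b * falling j (\<i> * of_real w) / rising (Suc j) (\<i> * of_real w)
        / ((falling n (\<i> * of_real w) + rising n (\<i> * of_real w)) / rising n (\<i> * of_real w)) + d
        = poly N2 (\<i> * of_real w) / poly D (\<i> * of_real w)"
      by (simp add: N2_def D_def F R)
    ultimately show ?thesis by (simp only: x)
  qed
  ultimately show ?thesis using \<open>N1 \<noteq> N2\<close> by blast
qed

text \<open>The diagonalization may be chosen freely for each size, and the feedthrough may vary
  with n. The existence of outputs is part of the claim, so the statement about all output families
  is not vacuous.\<close>

theorem theorem2:
  fixes l :: nat
    and V \<Lambda> :: "nat \<Rightarrow> complex mat"
    and d :: "nat \<Rightarrow> complex"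
  assumes "l \<ge> 1"
    and "\<And>n. n \<ge> l \<Longrightarrow> unitary_diagonalization n (cmat (legs_A_perp n)) (V n) (\<Lambda> n)"
  defines "DPLR \<equiv> \<lambda>n. DPLR_system l n (V n) (\<Lambda> n) (d n)"
    and "Diag \<equiv> \<lambda>n. Diag_system l n (V n) (\<Lambda> n) (d n)"
  shows
    "\<not> uniform_limit {s. Re s = 0}
        (\<lambda>n s. transfer_function (DPLR n) s - transfer_function (Diag n) s) (\<lambda>s. 0) sequentially
     \<and>
     (\<exists>u :: nat \<Rightarrow> real \<Rightarrow> complex.
        (\<forall>n\<ge>l. in_L1 (u n) \<and> in_L2 (u n) \<and>
               (\<exists>y. is_output (DPLR n) (u n) y) \<and> (\<exists>y. is_output (Diag n) (u n) y)) \<and>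
        (\<forall>y_DPLR y_Diag.
           (\<forall>n\<ge>l. is_output (DPLR n) (u n) (y_DPLR n) \<and> is_output (Diag n) (u n) (y_Diag n)) \<longrightarrow>
           \<not> (\<lambda>n. L2_norm (\<lambda>t. y_DPLR n t - y_Diag n t)) \<longlonglongrightarrow> 0))"
proof
  have G_DPLR: "transfer_function (DPLR n) (\<i> * of_real w) = legs_x (l - 1) (\<i> * of_real w) + d n"
    if "n \<ge> l" for n w
    unfolding DPLR_def by (rule transfer_function_DPLR[OF assms(1) that assms(2)[OF that]]) simp
  have G_Diag: "transfer_function (Diag n) (\<i> * of_real w)
      = legs_x (l - 1) (\<i> * of_real w) / (1 + legs_q n (\<i> * of_real w)) + d n"
    if "n \<ge> l" for n w
    unfolding Diag_def
    by (rule transfer_function_Diag[OF assms(1) that assms(2)[OF that]])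
      (use that assms(1) in \<open>auto intro!: one_plus_legs_q_nonzero simp del: of_real_eq_0_iff\<close>)
  show "\<not> uniform_limit {s. Re s = 0}
        (\<lambda>n s. transfer_function (DPLR n) s - transfer_function (Diag n) s) (\<lambda>s. 0) sequentially"
  proof
    assume "uniform_limit {s. Re s = 0}
        (\<lambda>n s. transfer_function (DPLR n) s - transfer_function (Diag n) s) (\<lambda>s. 0) sequentially"
    then have "\<forall>\<^sub>F n in sequentially. \<forall>s\<in>{s. Re s = 0}.
        dist (transfer_function (DPLR n) s - transfer_function (Diag n) s) 0 < 1 / 64"
      by (rule uniform_limitD) simp
    then obtain N where N: "\<And>n s. n \<ge> N \<Longrightarrow> Re s = 0 \<Longrightarrow>
        cmod (transfer_function (DPLR n) s - transfer_function (Diag n) s) < 1 / 64"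
      by (auto simp: eventually_sequentially)
    \<comment> \<open>A single size beyond the supposed threshold, at least \<open>l\<close> and at
      least 16, already violates the uniform bound 1 / 64.\<close>
    define n where "n = max N (max l 16)"
    have n: "n \<ge> N" "n \<ge> l" "n \<ge> 16" by (auto simp: n_def)
    from n assms(1) have "l - 1 < n" by simp
    from transfer_gap_lower_bound[OF n(3) this]
    obtain w where "1 / 64 \<le> cmod (legs_x (l - 1) (\<i> * of_real w)
        - legs_x (l - 1) (\<i> * of_real w) / (1 + legs_q n (\<i> * of_real w)))"
      by (elim exE)
    with N[OF n(1), of "\<i> * of_real w"] show False
      by (simp add: G_DPLR[OF n(2)] G_Diag[OF n(2)])
  qed
  have "\<exists>u. in_L1 u \<and> in_L2 u \<and> (\<exists>y. is_output (DPLR n) u y) \<and> (\<exists>y. is_output (Diag n) u y) \<and>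
    (\<forall>y1 y2. is_output (DPLR n) u y1 \<longrightarrow> is_output (Diag n) u y2 \<longrightarrow> 1 \<le> L2_norm (\<lambda>t. y1 t - y2 t))"
    if "n \<ge> l" for n
  proof -
    have "0 < n" using that assms(1) by simp
    from transfer_functions_common_denominator[OF this, of "l - 1" "d n"]
    obtain D N1 N2 where h: "N1 \<noteq> N2" "\<And>w. poly D (\<i> * of_real w) \<noteq> 0"
      "\<And>w. legs_x (l - 1) (\<i> * of_real w) + d n = poly N1 (\<i> * of_real w) / poly D (\<i> * of_real w)"
      "\<And>w. legs_x (l - 1) (\<i> * of_real w) / (1 + legs_q n (\<i> * of_real w)) + d n
       = poly N2 (\<i> * of_real w) / poly D (\<i> * of_real w)"
      by blast
    show ?thesis
    proof (rule input_separating_outputs[of "DPLR n" N1 D "Diag n" N2])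
      show "transfer_function (DPLR n) (\<i> * of_real w) = poly N1 (\<i> * of_real w) / poly D (\<i> * of_real w)" for w
        unfolding G_DPLR[OF that] by (rule h)
      show "transfer_function (Diag n) (\<i> * of_real w) = poly N2 (\<i> * of_real w) / poly D (\<i> * of_real w)" for w
        unfolding G_Diag[OF that] by (rule h)
    qed (rule h)+
  qed
  then obtain u where u: "\<And>n. n \<ge> l \<Longrightarrow> in_L1 (u n) \<and> in_L2 (u n) \<and>
      (\<exists>y. is_output (DPLR n) (u n) y) \<and> (\<exists>y. is_output (Diag n) (u n) y) \<and>
      (\<forall>y1 y2. is_output (DPLR n) (u n) y1 \<longrightarrow> is_output (Diag n) (u n) y2 \<longrightarrow> 1 \<le> L2_norm (\<lambda>t. y1 t - y2 t))"
    by metis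
  show "\<exists>u :: nat \<Rightarrow> real \<Rightarrow> complex.
        (\<forall>n\<ge>l. in_L1 (u n) \<and> in_L2 (u n) \<and>
               (\<exists>y. is_output (DPLR n) (u n) y) \<and> (\<exists>y. is_output (Diag n) (u n) y)) \<and>
        (\<forall>y_DPLR y_Diag.
           (\<forall>n\<ge>l. is_output (DPLR n) (u n) (y_DPLR n) \<and> is_output (Diag n) (u n) (y_Diag n)) \<longrightarrow>
           \<not> (\<lambda>n. L2_norm (\<lambda>t. y_DPLR n t - y_Diag n t)) \<longlonglongrightarrow> 0)"
  proof (rule exI[of _ u], rule conjI; intro allI impI notI)
    fix n assume "l \<le> n"
    from u[OF this] show "in_L1 (u n) \<and> in_L2 (u n) \<and>
        (\<exists>y. is_output (DPLR n) (u n) y) \<and> (\<exists>y. is_output (Diag n) (u n) y)" by blast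
  next
    fix y1 y2
    assume y: "\<forall>n\<ge>l. is_output (DPLR n) (u n) (y1 n) \<and> is_output (Diag n) (u n) (y2 n)"
      and lim: "(\<lambda>n. L2_norm (\<lambda>t. y1 n t - y2 n t)) \<longlonglongrightarrow> 0"
    \<comment> \<open>The inputs were normalized separately for each n, so the same bound 1 holds
      for all sizes and survives in the limit.\<close>
    have "1 \<le> L2_norm (\<lambda>t. y1 n t - y2 n t)" if "n \<ge> l" for n
      using u[OF that] y that by blast
    then have "1 \<le> (0::real)"
      by (intro LIMSEQ_le_const[OF lim]) auto
    then show False by simp
  qed
qed

end
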